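(* Let $s\ge3$, $n=2^s-1$ and $k=2^s-s-2$. There exists an $[[n,k]]_{\mathrm{Cl}}$ quantum code of even and odd Clifford distance $3$; that is, there is a $q$-isotropic subspace $C\subseteq\mathbb{F}_2^{2n}$ of dimension $n-k$ and a simultaneous eigenspace $\mathcal{C}\subseteq\mathcal{H}^{(n)}$ of the operators $\Gamma_x$, $x\in C$ (a quantum code of dimension $2^k$), whose distance is $3$ with respect to the even Clifford quantum metric $\mathcal{E}_t^{\mathrm{Cl}(2n)}$ and also $3$ with respect to the odd Clifford quantum metric $\mathcal{E}_t^{\mathrm{Cl}(2n+1)}$.
   Context: Clifford operators: $\mathcal{H}^{(n)}=(\mathbb{C}^2)^{\otimes n}$. With Pauli matrices $\sigma_x,\sigma_y,\sigma_z$, put $U_k=\sigma_z^{\otimes k-1}\otimes\sigma_x\otimes I_2^{\otimes n-k}$ and $U_{n+k}=\sigma_z^{\otimes k-1}\otimes\sigma_y\otimes I_2^{\otimes n-k}$ for $1\le k\le n$, and $U_{2n+1}=\sigma_z^{\otimes n}$. These are Hermitian, unitary and pairwise anticommuting. For $m\in\{2n,2n+1\}$ the Clifford quantum metric is $$\mathcal{E}_t^{\mathrm{Cl}(m)}=\operatorname{span}\{U_{k_1}\cdots U_{k_j}:1\le k_1<\dots<k_j\le m,\ 0\le j\le\lfloor t\rfloor\}$$ (empty product $=I$); $m=2n$ is the even one and $m=2n+1$ the odd one. For $x\in\mathbb{F}_2^{2n}$, $\Gamma_x=i^{\tau(x)}\prod_{k=1}^nU_k^{x_k}U_{n+k}^{x_{n+k}}$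 with $\tau(x)=\frac{\operatorname{wt}(x)(\operatorname{wt}(x)-1)}2$ and $\operatorname{wt}(x)$ the number of nonzero components. The bilinear form $q$ on $\mathbb{F}_2^{2n}$ is $q(x,y)=\operatorname{wt}(x)\operatorname{wt}(y)+x\cdot y \pmod 2$; a subspace $C$ is $q$-isotropic if $q(x,y)=0$ for all $x,y\in C$. Then the $\Gamma_x$, $x\in C$, commute. An $[[n,k]]_{\mathrm{Cl}}$ is any simultaneous eigenspace of $\{\Gamma_x:x\in C\}$ for a $q$-isotropic $C$ of dimension $n-k$. A quantum code is a subspace $\mathcal{C}$ with orthogonal projection $P$; it detects an operator $E$ if $PEP$ is a scalar multiple of $P$. Its distance with respect to a metric $\mathcal{E}_t$ is the largest $d$ such that it detects all $E\in\mathcal{E}_{d-1}$. *)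

theory Defs
  imports
    "Jordan_Normal_Form.Schur_Decomposition"
    "Jordan_Normal_Form.VS_Connect"
    "HOL-Library.Z2"
begin

subsection \<open>Linear algebra\<close>

abbreviation vec_subspace :: "nat \<Rightarrow> 'a :: field vec set \<Rightarrow> bool" where
  "vec_subspace N W \<equiv> VectorSpace.subspace class_ring W (module_vec TYPE('a) N)"

definition subspace_dim :: "nat \<Rightarrow> 'a :: field vec set \<Rightarrow> nat" where
  "subspace_dim N W =
     vectorspace.dim class_ring ((module_vec TYPE('a) N) \<lparr> carrier := W \<rparr>)"

definition mat_span :: "nat \<Rightarrow> 'a :: field mat set \<Rightarrow> 'a mat set" where
  "mat_span N S = LinearCombinations.module.span class_ring (module_mat TYPE('a) N N) S"

text \<open>Product, in the order of the list, of \<open>N\<close> by \<open>N\<close> matrices.\<close>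

definition mat_prod :: "nat \<Rightarrow> 'a :: semiring_1 mat list \<Rightarrow> 'a mat" where
  "mat_prod N As = foldr (*) As (1\<^sub>m N)"

definition kronecker :: "'a :: semiring_1 mat \<Rightarrow> 'a mat \<Rightarrow> 'a mat" where
  "kronecker A B = mat (dim_row A * dim_row B) (dim_col A * dim_col B)
     (\<lambda>(i, j). A $$ (i div dim_row B, j div dim_col B) * B $$ (i mod dim_row B, j mod dim_col B))"

definition tensor_list :: "'a :: semiring_1 mat list \<Rightarrow> 'a mat" where
  "tensor_list As = foldr kronecker As (1\<^sub>m 1)"


subsection \<open>Clifford operators\<close>

text \<open>The space of \<open>n\<close> qubits is \<open>carrier_vec (2 ^ n)\<close>, identified with the tensor power of
  \<open>carrier_vec 2\<close> by the basis in which operators on tensor factors become Kronecker products.\<close>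

definition pauli_x :: "complex mat" where
  "pauli_x = mat_of_rows_list 2 [[0, 1], [1, 0]]"

definition pauli_y :: "complex mat" where
  "pauli_y = mat_of_rows_list 2 [[0, - \<i>], [\<i>, 0]]"

definition pauli_z :: "complex mat" where
  "pauli_z = mat_of_rows_list 2 [[1, 0], [0, - 1]]"

text \<open>The indices run from \<open>1\<close> to \<open>2 * n + 1\<close>; other values of \<open>k\<close> are never used.\<close>

definition clifford_U :: "nat \<Rightarrow> nat \<Rightarrow> complex mat" where
  "clifford_U n k =
     (if 1 \<le> k \<and> k \<le> n then
        tensor_list (replicate (k - 1) pauli_z @ [pauli_x] @ replicate (n - k) (1\<^sub>m 2))
      else if n + 1 \<le> k \<and> k \<le> 2 * n then
        tensor_list (replicate (k - n - 1) pauli_z @ [pauli_y] @ replicate (2 * n - k) (1\<^sub>m 2))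
      else tensor_list (replicate n pauli_z))"

text \<open>The metric is even for \<open>m = 2 * n\<close> and odd for \<open>m = 2 * n + 1\<close>.
  For \<open>t < 0\<close> it is the zero space.\<close>

definition clifford_metric :: "nat \<Rightarrow> nat \<Rightarrow> real \<Rightarrow> complex mat set" where
  "clifford_metric n m t = mat_span (2 ^ n)
     {mat_prod (2 ^ n) (map (clifford_U n) ks) | ks.
        sorted_wrt (<) ks \<and> set ks \<subseteq> {1..m} \<and> int (length ks) \<le> \<lfloor>t\<rfloor>}"


subsection \<open>Isotropic subspaces and their codes\<close>

definition wt :: "'a :: zero vec \<Rightarrow> nat" where
  "wt x = card {i. i < dim_vec x \<and> x $ i \<noteq> 0}"

text \<open>Vectors are indexed from \<open>0\<close>, so that the component \<open>x\<^sub>k\<close> is \<open>x $ (k - 1)\<close>.\<close>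

definition clifford_\<Gamma> :: "nat \<Rightarrow> bit vec \<Rightarrow> complex mat" where
  "clifford_\<Gamma> n x = \<i> ^ (wt x * (wt x - 1) div 2) \<cdot>\<^sub>m
     mat_prod (2 ^ n)
       (map (\<lambda>k. clifford_U n k ^\<^sub>m of_bool (x $ (k - 1) = 1)
               * clifford_U n (n + k) ^\<^sub>m of_bool (x $ (n + k - 1) = 1)) [1..<n + 1])"

definition q_form :: "bit vec \<Rightarrow> bit vec \<Rightarrow> bit" where
  "q_form x y = of_nat (wt x * wt y) + x \<bullet> y"

definition q_isotropic :: "nat \<Rightarrow> bit vec set \<Rightarrow> bool" where
  "q_isotropic n C \<longleftrightarrow> vec_subspace (2 * n) C \<and> (\<forall>x\<in>C. \<forall>y\<in>C. q_form x y = 0)"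

text \<open>The function \<open>\<chi>\<close> gives the eigenvalues; an eigenspace is nonzero.\<close>

definition simultaneous_eigenspace :: "nat \<Rightarrow> bit vec set \<Rightarrow> complex vec set \<Rightarrow> bool" where
  "simultaneous_eigenspace n C W \<longleftrightarrow>
     (\<exists>\<chi>. W = {v \<in> carrier_vec (2 ^ n). \<forall>x\<in>C. clifford_\<Gamma> n x *\<^sub>v v = \<chi> x \<cdot>\<^sub>v v}) \<and>
     W \<noteq> {0\<^sub>v (2 ^ n)}"


subsection \<open>Error detection and distance\<close>

definition orthogonal_projection :: "nat \<Rightarrow> complex vec set \<Rightarrow> complex mat \<Rightarrow> bool" where
  "orthogonal_projection N W P \<longleftrightarrow>
     P \<in> carrier_mat N N \<and> mat_adjoint P = P \<and> P * P = P \<and>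
     (\<lambda>v. P *\<^sub>v v) ` carrier_vec N = W"

text \<open>The projection onto a subspace exists and is unique, so the quantifier over \<open>P\<close>
  merely names it.\<close>

definition detects :: "nat \<Rightarrow> complex vec set \<Rightarrow> complex mat \<Rightarrow> bool" where
  "detects N W E \<longleftrightarrow> (\<exists>P. orthogonal_projection N W P \<and> (\<exists>c. P * E * P = c \<cdot>\<^sub>m P))"

text \<open>\<open>d\<close> is the largest integer such that the code \<open>W\<close> detects all of \<open>\<E> (d - 1)\<close>.
  The subtraction is that of the reals, hence not truncated at \<open>d = 0\<close>.\<close>

definition has_distance ::
    "nat \<Rightarrow> (real \<Rightarrow> complex mat set) \<Rightarrow> complex vec set \<Rightarrow> nat \<Rightarrow> bool" where
  "has_distance N \<E> W d \<longleftrightarrow> vec_subspace N W \<and>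
     (\<forall>E \<in> \<E> (real d - 1). detects N W E) \<and>
     (\<forall>d'. (\<forall>E \<in> \<E> (real d' - 1). detects N W E) \<longrightarrow> d' \<le> d)"

end

(*
  Label the generator U_a by the binary expansion of a; the labels 1, ..., 2n+1 = 2^(s+1) - 1 are the
  nonzero vectors of length s+1. The j-th generator of C has component 1 at a exactly if bit j of a
  is 0. Its weight is odd, so Gamma anticommutes with U_a exactly if bit j of a is 1, also for
  a = 2n+1. The syndrome of a product of U_a's is therefore the XOR of their labels: the check matrix
  is that of the Hamming code. One label, or two different ones, have a nonzero XOR, so products of
  weight 1 or 2 are detected. On the other hand U_1 U_2 U_3 and U_4 U_8 U_12 preserve the code space
  and anticommute, so the first is not detected.
*)

theory Submission
  imports Defs "Jordan_Normal_Form.DL_Rank"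
begin

subsection \<open>Trace and rank of idempotent matrices\<close>

text \<open>The obstacle is the last generator. U_(2n+1) anticommutes with every other generator and
  has no coordinate in F_2^(2n), so it commutes with every Gamma_x of even weight: only odd weights
  can see it. A word of odd weight anticommutes exactly with the generators outside its support;
  hence supports are the sets where a bit is 0, and the label 2n+1, whose bits are all 1, fits in
  without a special role. One argument then serves both metrics: detection is shown for all 2n+1
  labels, while the undetected word uses labels up to 3 only. The phase i^tau(x) is never evaluated.
  Some scalar turns each generating word into a Hermitian involution, the code is the joint +1
  eigenspace of these involutions, and the eigenvalues \<chi> are read off afterwards. The dimension
  of the code is obtained as a trace: the projection is built from factors (1 + g) / 2, its trace is
  computed, and for an idempotent matrix the trace is the rank.\<close>

definition mat_trace :: "'a :: comm_ring_1 mat \<Rightarrow> 'a" where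
  "mat_trace A = (\<Sum>i<dim_row A. A $$ (i, i))"

lemma mat_trace_mult_commute:
  assumes A: "A \<in> carrier_mat n m" and B: "B \<in> carrier_mat m n"
  shows "mat_trace (A * B) = mat_trace (B * A)"
proof -
  have "mat_trace (A * B) = (\<Sum>i<n. \<Sum>j<m. A $$ (i, j) * B $$ (j, i))"
    using A B by (auto simp: mat_trace_def scalar_prod_def atLeast0LessThan intro!: sum.cong)
  also have "\<dots> = (\<Sum>j<m. \<Sum>i<n. B $$ (j, i) * A $$ (i, j))"
    by (subst sum.swap) (simp add: mult.commute)
  also have "\<dots> = mat_trace (B * A)"
    using A B by (auto simp: mat_trace_def scalar_prod_def atLeast0LessThan intro!: sum.cong)
  finally show ?thesis .
qed

lemma mat_trace_smult: "mat_trace (c \<cdot>\<^sub>m A) = c * mat_trace A" if "square_mat A"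
  using that by (simp add: mat_trace_def sum_distrib_left)

lemma mat_trace_add:
  assumes "A \<in> carrier_mat N N" "B \<in> carrier_mat N N"
  shows "mat_trace (A + B) = mat_trace A + mat_trace B"
  using assms by (simp add: mat_trace_def sum.distrib)

lemma mat_trace_one: "mat_trace (1\<^sub>m N :: 'a :: comm_ring_1 mat) = of_nat N"
  by (simp add: mat_trace_def)

text \<open>The elements satisfying Q form a submodule containing S, hence contain its span. The
  setting of an abstract module covers vectors over \<open>bit\<close> as well as the matrices of
  the metric.\<close>

lemma (in Module.module) span_induct [consumes 1, case_names zero base add smult]:
  assumes x: "x \<in> span S"
    and zero: "Q \<zero>\<^bsub>M\<^esub>"
    and base: "\<And>y. y \<in> S \<Longrightarrow> y \<in> carrier M \<and> Q y"
    and add: "\<And>y z. \<lbrakk>y \<in> carrier M; z \<in> carrier M; Q y; Q z\<rbrakk> \<Longrightarrow> Q (y \<oplus>\<^bsub>M\<^esub> z)"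
    and smult: "\<And>c y. \<lbrakk>c \<in> carrier R; y \<in> carrier M; Q y\<rbrakk> \<Longrightarrow> Q (c \<odot>\<^bsub>M\<^esub> y)"
  shows "Q x"
proof -
  have "submodule R {y \<in> carrier M. Q y} M"
    using zero add smult by unfold_locales auto
  then have "span S \<subseteq> {y \<in> carrier M. Q y}"
    by (rule span_is_subset[rotated]) (use base in auto)
  with x show ?thesis by auto
qed

lemma mat_eq_one_if_mult_vec:
  fixes A :: "'a :: comm_ring_1 mat"
  assumes A: "A \<in> carrier_mat n n" and *: "\<And>v. v \<in> carrier_vec n \<Longrightarrow> A *\<^sub>v v = v"
  shows "A = 1\<^sub>m n"
proof (rule eq_matI)
  fix i j assume ij: "i < dim_row (1\<^sub>m n :: 'a mat)" "j < dim_col (1\<^sub>m n :: 'a mat)"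
  then have "(A *\<^sub>v unit_vec n j) $ i = A $$ (i, j)"
    using A by (simp add: scalar_prod_right_unit)
  then show "A $$ (i, j) = 1\<^sub>m n $$ (i, j)"
    using *[of "unit_vec n j"] ij by simp
qed (use A in auto)

text \<open>A rank factorization \<open>P = A * B\<close> of an idempotent satisfies \<open>B * A = 1\<close>.\<close>

lemma (in vec_space) rank_idempotent:
  fixes P :: "'a mat"
  assumes P: "P \<in> carrier_mat n n" and idem: "P * P = P"
  shows "mat_trace P = of_nat (rank P)"
proof -
  let ?S = "set (cols P)"
  have S: "?S \<subseteq> carrier_vec n" using cols_dim P by blast
  then interpret W: vectorspace class_ring "vs (span ?S)"
    using subspace_is_vs[OF span_is_subspace] by blast
  obtain b where b: "finite b" "W.basis b"
    using W.finite_basis_exists fin_dim_span_cols[OF P] by auto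
  have rank: "rank P = card b"
    using b by (simp add: rank_def W.dim_basis)
  have bsub: "b \<subseteq> span ?S" using b unfolding W.basis_def by simp
  have li: "lin_indpt b" and sp: "span b = span ?S"
    using span_li_not_depend[OF bsub span_is_submodule[OF S]] b unfolding W.basis_def by auto
  obtain bs where bs: "set bs = b" "distinct bs"
    using finite_distinct_list b(1) by blast
  define d where "d = length bs"
  define A where "A = mat_of_cols n bs"
  have bn: "b \<subseteq> carrier_vec n" using bsub S span_closed by auto
  have A: "A \<in> carrier_mat n d" by (simp add: A_def d_def)
  have colsA: "cols A = bs" using bn bs by (simp add: A_def cols_mat_of_cols)
  \<comment> \<open>The columns of A are a basis of the column space of P, so A can be cancelled on
    the left; this is what yields B * A = 1 below.\<close>
  have inj: "v = 0\<^sub>v d" if "v \<in> carrier_vec d" "A *\<^sub>v v = 0\<^sub>v n" for v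
    using lin_depI[OF A that(1) _ that(2)] li colsA bs by auto
  have ex: "\<exists>w \<in> carrier_vec d. A *\<^sub>v w = col P j" if "j < n" for j
  proof -
    have "col P j \<in> ?S" using that P by (auto simp: cols_def)
    then have "col P j \<in> span b" using sp S span_mem by auto
    then obtain a where "col P j = lincomb a b"
      using finite_in_span[OF b(1) bn] by metis
    then have "A *\<^sub>v vec d (\<lambda>i. a (col A i)) = col P j"
      using mat_mult_eq_lincomb[OF A] colsA bs by simp
    then show ?thesis by (intro bexI) auto
  qed
  then obtain w where w: "\<And>j. j < n \<Longrightarrow> w j \<in> carrier_vec d \<and> A *\<^sub>v w j = col P j"
    by metis
  define B where "B = mat d n (\<lambda>(i, j). w j $ i)"
  have B: "B \<in> carrier_mat d n" by (simp add: B_def)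
  have PAB: "P = A * B"
  proof (rule mat_col_eqI)
    fix j assume "j < dim_col (A * B)"
    then have j: "j < n" using B by simp
    moreover have "col B j = w j"
      using j w[OF j] by (auto simp: B_def)
    ultimately show "col P j = col (A * B) j"
      using w[OF j] by (simp only: col_mult2[OF A B j])
  qed (use A B P in auto)
  \<comment> \<open>Idempotence says that P fixes each of its own columns, hence the column space,
    which contains every A v.\<close>
  have PA: "P *\<^sub>v (A *\<^sub>v v) = A *\<^sub>v v" if v: "v \<in> carrier_vec d" for v
  proof -
    have "P *\<^sub>v x = x" if "x \<in> span ?S" for x
      using that
    proof (induction rule: span_induct)
      case (base y)
      then obtain j where "j < n" "y = col P j" using P by (auto simp: cols_def)
      moreover have "P *\<^sub>v col P j = col (P * P) j" if "j < n" for j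
        by (rule col_mult2[OF P P that, symmetric])
      ultimately show ?case using idem P by simp
    next
      case (add y z)
      with P show ?case by (metis mult_add_distrib_mat_vec)
    next
      case (smult c y)
      with P show ?case by (metis mult_mat_vec)
    qed (use P in \<open>auto intro!: eq_vecI\<close>)
    moreover have "A *\<^sub>v v \<in> span b"
      using lincomb_eq_mat_mult[OF A v, symmetric] colsA bs b(1) unfolding span_def
      by auto
    ultimately show ?thesis using sp by simp
  qed
  have "B * A = 1\<^sub>m d"
  proof (rule mat_eq_one_if_mult_vec)
    fix v :: "'a vec" assume v: "v \<in> carrier_vec d"
    have "A *\<^sub>v ((B * A) *\<^sub>v v - v) = P *\<^sub>v (A *\<^sub>v v) - A *\<^sub>v v"
      using A B v by (simp add: PAB mult_minus_distrib_mat_vec)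
    also have "\<dots> = 0\<^sub>v n" using PA[OF v] A v by simp
    finally have "(B * A) *\<^sub>v v - v = 0\<^sub>v d"
      using A B v by (intro inj) auto
    then have "((B * A) *\<^sub>v v) $ i - v $ i = 0" if "i < d" for i
      using that A B v by (metis index_minus_vec(1) index_zero_vec(1) carrier_vecD)
    then show "(B * A) *\<^sub>v v = v"
      using A B v by (intro eq_vecI) simp_all
  qed (use A B in auto)
  \<comment> \<open>The traces of A * B and B * A agree, and the latter is the identity of size
    d.\<close>
  then have "mat_trace P = of_nat d"
    using mat_trace_mult_commute[OF A B] by (simp add: PAB mat_trace_one)
  then show ?thesis using rank bs by (simp add: d_def distinct_card[symmetric])
qed

subsection \<open>Kronecker products and Pauli matrices\<close>

lemma mat_adjoint_dim [simp]: "dim_row (mat_adjoint A) = dim_col A" "dim_col (mat_adjoint A) = dim_row A"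
  by (auto simp: mat_adjoint_def)

lemma mat_adjoint_carrier [simp]: "A \<in> carrier_mat n m \<Longrightarrow> mat_adjoint A \<in> carrier_mat m n"
  by auto

lemma mat_adjoint_index [simp]:
  "i < dim_col A \<Longrightarrow> j < dim_row A \<Longrightarrow> mat_adjoint A $$ (i, j) = conjugate (A $$ (j, i))"
  by (simp add: mat_adjoint_def mat_of_rows_def)

lemma mat_adjoint_mult:
  assumes "A \<in> carrier_mat n m" "B \<in> carrier_mat m l"
  shows "mat_adjoint (A * B) = mat_adjoint B * mat_adjoint A"
  using assms
  by (intro eq_matI) (auto simp: scalar_prod_def sum_conjugate conjugate_dist_mul mult.commute)

lemma mat_adjoint_add:
  assumes "A \<in> carrier_mat n m" "B \<in> carrier_mat n m"
  shows "mat_adjoint (A + B) = mat_adjoint A + mat_adjoint B"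
  using assms by (intro eq_matI) (auto simp: conjugate_dist_add)

lemma mat_adjoint_smult: "mat_adjoint (c \<cdot>\<^sub>m A) = conjugate c \<cdot>\<^sub>m mat_adjoint A"
  by (intro eq_matI) (auto simp: conjugate_dist_mul)

lemma mat_adjoint_one [simp]: "mat_adjoint (1\<^sub>m N) = (1\<^sub>m N :: complex mat)"
  by (intro eq_matI) auto

lemma kronecker_carrier:
  "A \<in> carrier_mat a b \<Longrightarrow> B \<in> carrier_mat c d \<Longrightarrow> kronecker A B \<in> carrier_mat (a * c) (b * d)"
  by (auto simp: kronecker_def)

text \<open>An index k * d + l is the flattened pair (k, l), the layout used by
  \<open>kronecker\<close>; this splits the sum over the middle index in a product of Kronecker
  products.\<close>

lemma sum_lessThan_mult:
  "sum h {..<b * d :: nat} = (\<Sum>k<b. \<Sum>l<d. h (k * d + l))"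
proof -
  have "sum h {k * d..<k * d + d} = (\<Sum>l<d. h (k * d + l))" for k
    using sum.shift_bounds_nat_ivl[of h 0 "k * d" d] by (simp add: atLeast0LessThan add.commute)
  then show ?thesis by (simp flip: sum.nat_group)
qed

lemma kronecker_mult:
  fixes A :: "'a :: comm_semiring_1 mat"
  assumes A: "A \<in> carrier_mat a b" and B: "B \<in> carrier_mat c d"
    and A': "A' \<in> carrier_mat b a'" and B': "B' \<in> carrier_mat d c'"
  shows "kronecker A B * kronecker A' B' = kronecker (A * A') (B * B')"
proof (rule eq_matI)
  fix i j assume "i < dim_row (kronecker (A * A') (B * B'))" "j < dim_col (kronecker (A * A') (B * B'))"
  then have i: "i < a * c" and j: "j < a' * c'" using assms by (auto simp: kronecker_def)
  \<comment> \<open>Dimensions may be 0, but an index in range excludes this; remainders modulo c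
    and c' are then in range too.\<close>
  then have pos: "0 < c" "0 < c'" by (auto intro: gr0I)
  have ij: "i div c < a" "i mod c < c" "j div c' < a'" "j mod c' < c'"
    using i j pos by (auto simp: less_mult_imp_div_less)
  have "(kronecker A B * kronecker A' B') $$ (i, j) =
      (\<Sum>k<b * d. A $$ (i div c, k div d) * B $$ (i mod c, k mod d) *
                 (A' $$ (k div d, j div c') * B' $$ (k mod d, j mod c')))"
    using i j assms by (simp add: kronecker_def scalar_prod_def atLeast0LessThan)
  also have "\<dots> = (\<Sum>k<b. \<Sum>l<d. A $$ (i div c, k) * B $$ (i mod c, l) *
                 (A' $$ (k, j div c') * B' $$ (l, j mod c')))"
    by (subst sum_lessThan_mult) (auto intro!: sum.cong)
  also have "\<dots> = (\<Sum>k<b. A $$ (i div c, k) * A' $$ (k, j div c')) *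
                (\<Sum>l<d. B $$ (i mod c, l) * B' $$ (l, j mod c'))"
    by (simp add: sum_product ac_simps)
  also have "\<dots> = kronecker (A * A') (B * B') $$ (i, j)"
    using i j ij assms by (simp add: kronecker_def scalar_prod_def atLeast0LessThan)
  finally show "(kronecker A B * kronecker A' B') $$ (i, j) = kronecker (A * A') (B * B') $$ (i, j)" .
qed (use assms in \<open>auto simp: kronecker_def\<close>)

lemma kronecker_adjoint: 
  "mat_adjoint (kronecker A B) = kronecker (mat_adjoint A) (mat_adjoint B :: complex mat)"
proof (rule eq_matI)
  fix i j assume "i < dim_row (kronecker (mat_adjoint A) (mat_adjoint B))"
    "j < dim_col (kronecker (mat_adjoint A) (mat_adjoint B))"
  then have i: "i < dim_col A * dim_col B" and j: "j < dim_row A * dim_row B"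
    by (auto simp: kronecker_def)
  then have "0 < dim_col B" "0 < dim_row B" by (auto intro: gr0I)
  then show "mat_adjoint (kronecker A B) $$ (i, j) = kronecker (mat_adjoint A) (mat_adjoint B) $$ (i, j)"
    using i j by (auto simp: kronecker_def less_mult_imp_div_less)
qed (auto simp: kronecker_def)

lemma kronecker_smult:
  fixes A :: "'a :: comm_semiring_1 mat"
  shows "kronecker (c \<cdot>\<^sub>m A) (d \<cdot>\<^sub>m B) = (c * d) \<cdot>\<^sub>m kronecker A B"
proof (rule eq_matI)
  fix i j assume "i < dim_row ((c * d) \<cdot>\<^sub>m kronecker A B)" "j < dim_col ((c * d) \<cdot>\<^sub>m kronecker A B)"
  then have i: "i < dim_row A * dim_row B" and j: "j < dim_col A * dim_col B"
    by (auto simp: kronecker_def)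
  then have "0 < dim_col B" "0 < dim_row B" by (auto intro: gr0I)
  then show "kronecker (c \<cdot>\<^sub>m A) (d \<cdot>\<^sub>m B) $$ (i, j) = ((c * d) \<cdot>\<^sub>m kronecker A B) $$ (i, j)"
    using i j by (auto simp: kronecker_def less_mult_imp_div_less ac_simps)
qed (auto simp: kronecker_def)

lemma kronecker_one: "kronecker (1\<^sub>m a) (1\<^sub>m b) = (1\<^sub>m (a * b) :: 'a :: semiring_1 mat)"
proof (rule eq_matI)
  fix i j assume "i < dim_row (1\<^sub>m (a * b) :: 'a mat)" "j < dim_col (1\<^sub>m (a * b) :: 'a mat)"
  then have ij: "i < a * b" "j < a * b" by auto
  then have "0 < b" by (auto intro: gr0I)
  moreover have "i div b = j div b \<and> i mod b = j mod b \<longleftrightarrow> i = j"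
    by (metis div_mult_mod_eq)
  ultimately show "kronecker (1\<^sub>m a) (1\<^sub>m b) $$ (i, j) = (1\<^sub>m (a * b) :: 'a mat) $$ (i, j)"
    using ij by (auto simp: kronecker_def less_mult_imp_div_less)
qed (auto simp: kronecker_def)

lemma tensor_list_simps [simp]:
  "tensor_list [] = 1\<^sub>m 1"
  "tensor_list (A # As) = kronecker A (tensor_list As)"
  by (auto simp: tensor_list_def)

lemma tensor_list_carrier:
  assumes "\<And>i. i \<in> set xs \<Longrightarrow> p i \<in> carrier_mat d d"
  shows "tensor_list (map p xs) \<in> carrier_mat (d ^ length xs) (d ^ length xs)"
  using assms by (induction xs) (auto intro!: kronecker_carrier)

text \<open>Both tensors run over the same list \<open>xs\<close>, so their lengths agree by
  construction and operators can be compared site by site.\<close>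

lemma tensor_list_mult:
  fixes p q :: "'b \<Rightarrow> 'a :: comm_semiring_1 mat"
  assumes "\<And>i. i \<in> set xs \<Longrightarrow> p i \<in> carrier_mat d d" "\<And>i. i \<in> set xs \<Longrightarrow> q i \<in> carrier_mat d d"
  shows "tensor_list (map p xs) * tensor_list (map q xs) = tensor_list (map (\<lambda>i. p i * q i) xs)"
  using assms
proof (induction xs)
  case (Cons x xs)
  have "kronecker (p x) (tensor_list (map p xs)) * kronecker (q x) (tensor_list (map q xs)) =
      kronecker (p x * q x) (tensor_list (map p xs) * tensor_list (map q xs))"
    using Cons.prems by (intro kronecker_mult[of _ d d _ "d ^ length xs" "d ^ length xs" _ d _ "d ^ length xs"] tensor_list_carrier) auto
  with Cons show ?case by simp
qed simp

lemma tensor_list_adjoint: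
  fixes p :: "'b \<Rightarrow> complex mat"
  shows "mat_adjoint (tensor_list (map p xs)) = tensor_list (map (\<lambda>i. mat_adjoint (p i)) xs)"
  by (induction xs) (auto simp: kronecker_adjoint)

lemma tensor_list_smult:
  fixes p :: "'b \<Rightarrow> 'a :: comm_semiring_1 mat"
  shows "tensor_list (map (\<lambda>i. c i \<cdot>\<^sub>m p i) xs) = prod_list (map c xs) \<cdot>\<^sub>m tensor_list (map p xs)"
  by (induction xs) (auto simp: kronecker_smult)

lemma tensor_list_one:
  "tensor_list (map (\<lambda>i. 1\<^sub>m d) xs) = (1\<^sub>m (d ^ length xs) :: 'a :: semiring_1 mat)"
  by (induction xs) (auto simp: kronecker_one)

text \<open>The factor of U_k at site i, counted from 0. The string of z's ends at site m; for k =
  2n+1 this is n, one past the last site, so that all three kinds of generators have the same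
  shape.\<close>

definition pauli_at :: "nat \<Rightarrow> nat \<Rightarrow> nat \<Rightarrow> complex mat" where
  "pauli_at n k i =
     (let m = if k \<le> n then k - 1 else if k \<le> 2 * n then k - n - 1 else n
      in if i < m then pauli_z else if i = m then (if k \<le> n then pauli_x else pauli_y) else 1\<^sub>m 2)"

lemma pauli_carrier [simp]:
  "pauli_x \<in> carrier_mat 2 2" "pauli_y \<in> carrier_mat 2 2" "pauli_z \<in> carrier_mat 2 2"
  by (auto simp: pauli_x_def pauli_y_def pauli_z_def mat_of_rows_list_def)

lemma pauli_dim [simp]:
  "dim_row pauli_x = 2" "dim_col pauli_x = 2" "dim_row pauli_y = 2" "dim_col pauli_y = 2"
  "dim_row pauli_z = 2" "dim_col pauli_z = 2"
  by (auto simp: pauli_x_def pauli_y_def pauli_z_def mat_of_rows_list_def)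

lemma pauli_index:
  "pauli_x $$ (0, 0) = 0" "pauli_x $$ (0, Suc 0) = 1" "pauli_x $$ (Suc 0, 0) = 1" "pauli_x $$ (Suc 0, Suc 0) = 0"
  "pauli_y $$ (0, 0) = 0" "pauli_y $$ (0, Suc 0) = - \<i>" "pauli_y $$ (Suc 0, 0) = \<i>" "pauli_y $$ (Suc 0, Suc 0) = 0"
  "pauli_z $$ (0, 0) = 1" "pauli_z $$ (0, Suc 0) = 0" "pauli_z $$ (Suc 0, 0) = 0" "pauli_z $$ (Suc 0, Suc 0) = - 1"
  by (auto simp: pauli_x_def pauli_y_def pauli_z_def mat_of_rows_list_def)

lemma pauli_adjoint [simp]:
  "mat_adjoint pauli_x = pauli_x" "mat_adjoint pauli_y = pauli_y" "mat_adjoint pauli_z = pauli_z"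
  by (intro eq_matI; auto simp: less_2_cases_iff pauli_index)+

lemma pauli_mult:
  "pauli_x * pauli_x = 1\<^sub>m 2" "pauli_y * pauli_y = 1\<^sub>m 2" "pauli_z * pauli_z = 1\<^sub>m 2"
  "pauli_x * pauli_y = \<i> \<cdot>\<^sub>m pauli_z" "pauli_y * pauli_x = - \<i> \<cdot>\<^sub>m pauli_z"
  "pauli_y * pauli_z = \<i> \<cdot>\<^sub>m pauli_x" "pauli_z * pauli_y = - \<i> \<cdot>\<^sub>m pauli_x"
  "pauli_z * pauli_x = \<i> \<cdot>\<^sub>m pauli_y" "pauli_x * pauli_z = - \<i> \<cdot>\<^sub>m pauli_y"
  by (intro eq_matI;
      auto simp: less_Suc_eq pauli_index scalar_prod_def numeral_2_eq_2)+

lemma pauli_at_carrier [simp]: "pauli_at n k i \<in> carrier_mat 2 2"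
  by (simp add: pauli_at_def Let_def)

lemma pauli_at_adjoint: "mat_adjoint (pauli_at n k i) = pauli_at n k i"
  by (simp add: pauli_at_def Let_def)

lemma pauli_at_square: "pauli_at n k i * pauli_at n k i = 1\<^sub>m 2"
  by (simp add: pauli_at_def Let_def pauli_mult)

lemma clifford_U_eq:
  assumes "k \<in> {1..2 * n + 1}"
  shows "clifford_U n k = tensor_list (map (pauli_at n k) [0..<n])"
proof -
  consider (x) "1 \<le> k" "k \<le> n" | (y) "n + 1 \<le> k" "k \<le> 2 * n" | (z) "k = 2 * n + 1"
    using assms by fastforce
  then show ?thesis
  proof cases
    case x
    then have "replicate (k - 1) pauli_z @ [pauli_x] @ replicate (n - k) (1\<^sub>m 2) = map (pauli_at n k) [0..<n]"
      by (intro nth_equalityI) (auto simp: pauli_at_def nth_append nth_Cons')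
    with x show ?thesis by (simp add: clifford_U_def)
  next
    case y
    then have "replicate (k - n - 1) pauli_z @ [pauli_y] @ replicate (2 * n - k) (1\<^sub>m 2) = map (pauli_at n k) [0..<n]"
      by (intro nth_equalityI) (auto simp: pauli_at_def nth_append nth_Cons')
    with y show ?thesis by (simp add: clifford_U_def)
  next
    case z
    then have "replicate n pauli_z = map (pauli_at n k) [0..<n]"
      by (intro nth_equalityI) (auto simp: pauli_at_def)
    with z show ?thesis by (simp add: clifford_U_def)
  qed
qed

lemma clifford_U_carrier:
  "k \<in> {1..2 * n + 1} \<Longrightarrow> clifford_U n k \<in> carrier_mat (2 ^ n) (2 ^ n)"
  using tensor_list_carrier[of "[0..<n]" "pauli_at n k" 2] by (simp add: clifford_U_eq)

lemma clifford_U_adjoint: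
  "k \<in> {1..2 * n + 1} \<Longrightarrow> mat_adjoint (clifford_U n k) = clifford_U n k"
  by (simp add: clifford_U_eq tensor_list_adjoint pauli_at_adjoint)

lemma clifford_U_square:
  "k \<in> {1..2 * n + 1} \<Longrightarrow> clifford_U n k * clifford_U n k = 1\<^sub>m (2 ^ n)"
  by (simp add: clifford_U_eq tensor_list_mult[of _ _ 2] pauli_at_square tensor_list_one)

text \<open>The Pauli matrices of two different \<open>U\<^sub>k\<close> anticommute at exactly one tensor factor.\<close>

lemma clifford_U_anticommute:
  assumes a: "a \<in> {1..2 * n + 1}" and b: "b \<in> {1..2 * n + 1}" and "a \<noteq> b"
  shows "clifford_U n a * clifford_U n b = - 1 \<cdot>\<^sub>m (clifford_U n b * clifford_U n a)"
proof -
  define site where "site k = (if k \<le> n then k - 1 else if k \<le> 2 * n then k - n - 1 else n)" for k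
  \<comment> \<open>Before site m both factors are z, at m they are two different Pauli matrices,
    and beyond m at least one of them is the identity.\<close>
  define m where "m = min (site a) (site b)"
  define c :: "nat \<Rightarrow> complex" where "c i = (if i = m then - 1 else 1)" for i
  \<comment> \<open>At most one of a and b is 2n+1, the only index whose site is n.\<close>
  have m: "m < n" using assms by (auto simp: m_def site_def)
  have at: "pauli_at n k i = (if i < site k then pauli_z else if i = site k then
      (if k \<le> n then pauli_x else pauli_y) else 1\<^sub>m 2)" for k i
    by (simp add: pauli_at_def site_def Let_def)
  \<comment> \<open>Exactly two strings end at each site below n, one with x and one with y.\<close>
  have same: "a \<le> n \<longleftrightarrow> \<not> b \<le> n" if "site a = site b"
    using that assms by (auto simp: site_def split: if_splits)
  have "pauli_at n a i * pauli_at n b i = c i \<cdot>\<^sub>m (pauli_at n b i * pauli_at n a i)" for i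
    using same by (auto simp: at c_def m_def pauli_mult min_def)
  then have "clifford_U n a * clifford_U n b = prod_list (map c [0..<n]) \<cdot>\<^sub>m (clifford_U n b * clifford_U n a)"
    using a b by (simp add: clifford_U_eq tensor_list_mult[of _ _ 2] tensor_list_smult)
  also have "prod_list (map c [0..<n]) = - 1"
    using m by (simp add: c_def prod.distinct_set_conv_list[symmetric] prod.delta)
  finally show ?thesis .
qed

subsection \<open>Stabilizers and words in the Clifford generators\<close>

lemma smult_smult_mat [simp]: "c \<cdot>\<^sub>m (d \<cdot>\<^sub>m A) = (c * d :: 'a :: semigroup_mult) \<cdot>\<^sub>m A"
  by (intro eq_matI) (auto simp: mult.assoc)

lemma one_smult_mat [simp]: "(1 :: 'a :: monoid_mult) \<cdot>\<^sub>m A = A"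
  by (intro eq_matI) auto

lemma smult_mat_mult_vec:
  "v \<in> carrier_vec (dim_col A) \<Longrightarrow> (c \<cdot>\<^sub>m A) *\<^sub>v v = (c :: 'a :: comm_semiring_0) \<cdot>\<^sub>v (A *\<^sub>v v)"
  by (intro eq_vecI) (auto simp: scalar_prod_def sum_distrib_left mult.assoc)

text \<open>With the scalar explicit, moving A past a product multiplies scalars, and a commutation
  sign becomes a parity count.\<close>

definition commute_up_to :: "complex \<Rightarrow> complex mat \<Rightarrow> complex mat \<Rightarrow> bool" where
  "commute_up_to c A B \<longleftrightarrow> A * B = c \<cdot>\<^sub>m (B * A)"

lemma commute_up_to_one: "A \<in> carrier_mat N N \<Longrightarrow> commute_up_to 1 A (1\<^sub>m N)"
  by (auto simp: commute_up_to_def)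

lemma commute_up_to_mult:
  assumes "A \<in> carrier_mat N N" "B \<in> carrier_mat N N" "C \<in> carrier_mat N N"
    and "commute_up_to b A B" "commute_up_to c A C"
  shows "commute_up_to (b * c) A (B * C)"
proof -
  have "A * (B * C) = (A * B) * C" using assms(1-3) by simp
  also have "\<dots> = b \<cdot>\<^sub>m (B * (A * C))"
    using assms by (simp add: commute_up_to_def mult_smult_assoc_mat[of _ N N _ N])
  also have "\<dots> = (b * c) \<cdot>\<^sub>m (B * C * A)"
    using assms by (simp add: commute_up_to_def mult_smult_distrib[of _ N N _ N])
  finally show ?thesis by (simp add: commute_up_to_def)
qed

lemma commute_up_to_sym:
  assumes "commute_up_to c A B" "c * c = 1"
  shows "commute_up_to c B A"
  using assms by (simp add: commute_up_to_def)

lemma commute_up_to_smult: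
  assumes "A \<in> carrier_mat N N" "B \<in> carrier_mat N N" "commute_up_to c A B"
  shows "commute_up_to c A (d \<cdot>\<^sub>m B)"
  using assms
  by (simp add: commute_up_to_def mult_smult_distrib[of _ N N _ N] mult_smult_assoc_mat[of _ N N _ N] mult.commute)

lemma mat_prod_simps [simp]:
  "mat_prod N [] = 1\<^sub>m N"
  "mat_prod N (A # As) = A * mat_prod N As"
  by (auto simp: mat_prod_def)

lemma mat_prod_carrier:
  "(\<And>A. A \<in> set As \<Longrightarrow> A \<in> carrier_mat N N) \<Longrightarrow> mat_prod N As \<in> carrier_mat N N"
  by (induction As) (auto intro!: mult_carrier_mat)

lemma commute_up_to_mat_prod:
  assumes "A \<in> carrier_mat N N"
    and "\<And>x. x \<in> set xs \<Longrightarrow> f x \<in> carrier_mat N N \<and> commute_up_to (c x) A (f x)"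
  shows "commute_up_to (prod_list (map c xs)) A (mat_prod N (map f xs))"
  using assms(2)
proof (induction xs)
  case (Cons x xs)
  then show ?case
    using assms(1) mat_prod_carrier[of "map f xs" N]
    by (auto intro!: commute_up_to_mult[of _ N])
qed (use assms(1) in \<open>auto intro: commute_up_to_one\<close>)

text \<open>The projection onto the common eigenspace is built by adding one stabilizer at a time. Each
  \<open>F j\<close> anticommutes with \<open>G j\<close> only, so it makes the trace of \<open>P * G j\<close> vanish for the projection
  \<open>P\<close> of the earlier stabilizers: every stabilizer halves the trace.\<close>

lemma stabilizer_projection:
  fixes G F :: "nat \<Rightarrow> complex mat"
  assumes carrier: "\<And>j. j < r \<Longrightarrow> G j \<in> carrier_mat N N" "\<And>j. j < r \<Longrightarrow> F j \<in> carrier_mat N N"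
    and adj: "\<And>j. j < r \<Longrightarrow> mat_adjoint (G j) = G j"
    and sq: "\<And>j. j < r \<Longrightarrow> G j * G j = 1\<^sub>m N" "\<And>j. j < r \<Longrightarrow> F j * F j = 1\<^sub>m N"
    and comm: "\<And>i j. i < r \<Longrightarrow> j < r \<Longrightarrow> G i * G j = G j * G i"
    and anti: "\<And>i j. i < r \<Longrightarrow> j < r \<Longrightarrow> commute_up_to (if i = j then - 1 else 1) (F i) (G j)"
  shows "\<exists>P \<in> carrier_mat N N. mat_adjoint P = P \<and> P * P = P \<and> (\<forall>j<r. G j * P = P) \<and>
           (\<forall>v \<in> carrier_vec N. (\<forall>j<r. G j *\<^sub>v v = v) \<longrightarrow> P *\<^sub>v v = v) \<and>
           (\<forall>X \<in> carrier_mat N N. (\<forall>j<r. X * G j = G j * X) \<longrightarrow> X * P = P * X) \<and>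
           mat_trace P = of_nat N / 2 ^ r"
  using assms
proof (induction r)
  case 0
  show ?case
    by (intro bexI[of _ "1\<^sub>m N"]) (auto simp: mat_trace_one)
next
  case (Suc r)
  have "\<exists>P \<in> carrier_mat N N. mat_adjoint P = P \<and> P * P = P \<and> (\<forall>j<r. G j * P = P) \<and>
           (\<forall>v \<in> carrier_vec N. (\<forall>j<r. G j *\<^sub>v v = v) \<longrightarrow> P *\<^sub>v v = v) \<and>
           (\<forall>X \<in> carrier_mat N N. (\<forall>j<r. X * G j = G j * X) \<longrightarrow> X * P = P * X) \<and>
           mat_trace P = of_nat N / 2 ^ r"
    by (rule Suc.IH) (use Suc.prems in auto)
  then obtain P where P: "P \<in> carrier_mat N N" "mat_adjoint P = P" "P * P = P"
      "\<And>j. j < r \<Longrightarrow> G j * P = P"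
      "\<And>v. v \<in> carrier_vec N \<Longrightarrow> (\<And>j. j < r \<Longrightarrow> G j *\<^sub>v v = v) \<Longrightarrow> P *\<^sub>v v = v"
      "\<And>X. X \<in> carrier_mat N N \<Longrightarrow> (\<And>j. j < r \<Longrightarrow> X * G j = G j * X) \<Longrightarrow> X * P = P * X"
      "mat_trace P = of_nat N / 2 ^ r"
    by blast
  define g f where "g = G r" and "f = F r"
  have g: "g \<in> carrier_mat N N" "mat_adjoint g = g" "g * g = 1\<^sub>m N" and f: "f \<in> carrier_mat N N" "f * f = 1\<^sub>m N"
    using Suc.prems by (auto simp: g_def f_def)
  have fg: "f * g = - 1 \<cdot>\<^sub>m (g * f)"
    using Suc.prems(7)[of r r] by (simp add: commute_up_to_def g_def f_def)
  \<comment> \<open>The commutation clause of the induction hypothesis serves these two facts: the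
    new stabilizer and its partner f commute with all earlier stabilizers, hence with P.\<close>
  have gP: "g * P = P * g"
    using P(6)[OF g(1)] Suc.prems(6) by (simp add: g_def)
  have fP: "f * P = P * f"
    using P(6)[OF f(1)] Suc.prems(7) by (simp add: f_def commute_up_to_def)
  note assoc = assoc_mult_mat[of _ N N _ N _ N]
  \<comment> \<open>The projection onto the +1 eigenspace of g, since g * g = 1.\<close>
  define Q where "Q = (1 / 2) \<cdot>\<^sub>m (1\<^sub>m N + g)"
  have Q: "Q \<in> carrier_mat N N" using g by (simp add: Q_def)
  have gQ: "g * Q = Q"
    using g by (simp add: Q_def mult_smult_distrib[of _ N N _ N] mult_add_distrib_mat[of _ N N _ N]
        comm_add_mat[of _ N N])
  have QQ: "Q * Q = Q"
  proof -
    have "Q * Q = (1 / 2) \<cdot>\<^sub>m (Q + g * Q)"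
      using g Q by (subst (1) Q_def)
        (simp add: mult_smult_assoc_mat[of _ N N _ N] add_mult_distrib_mat[of _ N N _ _ N])
    also have "\<dots> = Q" using Q by (intro eq_matI) (auto simp: gQ)
    finally show ?thesis .
  qed
  have comm_Q: "X * Q = Q * X" if X: "X \<in> carrier_mat N N" "X * g = g * X" for X
    using X g by (simp add: Q_def mult_smult_distrib[of _ N N _ N] mult_smult_assoc_mat[of _ N N _ N]
        mult_add_distrib_mat[of _ N N _ N] add_mult_distrib_mat[of _ N N _ _ N])
  have PQ: "P * Q = Q * P" using comm_Q P(1) gP by simp
  \<comment> \<open>Insert f * f = 1, cycle one f to the front and move it through P and past g; the
    sign picked up at g shows that the trace equals its own negative.\<close>
  have "mat_trace (P * g) = mat_trace (P * g * (f * f))"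
    using P g f by simp
  also have "\<dots> = mat_trace (f * (P * g * f))"
    using mat_trace_mult_commute[of "P * g * f" N N f] P g f by (simp add: assoc)
  also have "f * (P * g * f) = (f * P) * (g * f)"
    using P g f by (simp add: assoc)
  also have "\<dots> = P * (f * g) * f"
    using P g f by (simp add: fP assoc)
  also have "\<dots> = - 1 \<cdot>\<^sub>m (P * g * (f * f))"
    using P g f by (simp only: fg)
      (simp add: assoc mult_smult_distrib[of _ N N _ N] mult_smult_assoc_mat[of _ N N _ N])
  also have "mat_trace \<dots> = - mat_trace (P * g)"
    using P g f by (subst mat_trace_smult) auto
  finally have tr: "mat_trace (P * g) = 0" by simp
  show ?case
  proof (intro bexI[of _ "P * Q"] conjI allI impI ballI)
    show "P * Q \<in> carrier_mat N N" using P Q by simp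
    have "mat_adjoint Q = Q"
      using g by (simp add: Q_def mat_adjoint_smult mat_adjoint_add[of _ N N])
    then show "mat_adjoint (P * Q) = P * Q"
      using P Q by (simp add: mat_adjoint_mult[of _ N N _ N] PQ)
    have "P * Q * (P * Q) = P * (Q * P) * Q" using P Q by (simp add: assoc)
    also have "\<dots> = P * P * (Q * Q)" using P(1) Q unfolding PQ[symmetric] by (simp add: assoc)
    finally show "P * Q * (P * Q) = P * Q" using P QQ by simp
    show "G j * (P * Q) = P * Q" if "j < Suc r" for j
    proof (cases "j = r")
      case True
      have "g * (P * Q) = P * (g * Q)"
        using P(1) g Q gP by (metis assoc)
      then show ?thesis using gQ True by (simp add: g_def)
    next
      case False
      then have "j < r" using that by simp
      then show ?thesis using P Q Suc.prems(1)[OF that] by (metis assoc)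
    qed
    show "P * Q *\<^sub>v v = v" if v: "v \<in> carrier_vec N" "\<forall>j<Suc r. G j *\<^sub>v v = v" for v
    proof -
      have "g *\<^sub>v v = v" using v by (simp add: g_def)
      then have "Q *\<^sub>v v = v"
        using v g by (auto simp: Q_def smult_mat_mult_vec add_mult_distrib_mat_vec[of _ N N])
      then show ?thesis using P(1,5) Q v by simp
    qed
    show "X * (P * Q) = P * Q * X" if X: "X \<in> carrier_mat N N" "\<forall>j<Suc r. X * G j = G j * X" for X
    proof -
      have "X * P = P * X" "X * Q = Q * X"
        using P(6)[OF X(1)] comm_Q[OF X(1)] X(2) by (auto simp: g_def)
      then show ?thesis using X P(1) Q by (metis assoc)
    qed
    have "P * Q = (1 / 2) \<cdot>\<^sub>m (P + P * g)"
      using P g by (simp add: Q_def mult_smult_distrib[of _ N N _ N] mult_add_distrib_mat[of _ N N _ N])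
    then show "mat_trace (P * Q) = of_nat N / 2 ^ Suc r"
      using P g tr by (simp add: mat_trace_smult mat_trace_add[of _ N])
  qed
qed

section \<open>Words in the Clifford generators\<close>

text \<open>Arbitrary lists are allowed, so that one calculus covers the increasing words of the
  metric and the words behind \<open>clifford_\<Gamma>\<close>, whose letters come in another
  order.\<close>

definition cl_word :: "nat \<Rightarrow> nat list \<Rightarrow> complex mat" where
  "cl_word n ks = mat_prod (2 ^ n) (map (clifford_U n) ks)"

lemma cl_word_simps [simp]:
  "cl_word n [] = 1\<^sub>m (2 ^ n)"
  "cl_word n (k # ks) = clifford_U n k * cl_word n ks"
  by (simp_all add: cl_word_def)

lemma cl_word_carrier:
  "set ks \<subseteq> {1..2 * n + 1} \<Longrightarrow> cl_word n ks \<in> carrier_mat (2 ^ n) (2 ^ n)"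
  unfolding cl_word_def by (rule mat_prod_carrier) (use clifford_U_carrier in auto)

lemma prod_list_minus_one: 
  "prod_list (map (\<lambda>x. if Q x then - 1 else 1) xs) = (- 1 :: 'a :: comm_ring_1) ^ length (filter Q xs)"
  by (induction xs) auto

text \<open>Every letter different from a contributes a factor -1, and the letter a itself
  contributes 1.\<close>

lemma clifford_U_commute_cl_word:
  assumes "a \<in> {1..2 * n + 1}" "set ks \<subseteq> {1..2 * n + 1}"
  shows "commute_up_to ((- 1) ^ length (filter (\<lambda>b. b \<noteq> a) ks)) (clifford_U n a) (cl_word n ks)"
  unfolding cl_word_def prod_list_minus_one[symmetric]
proof (rule commute_up_to_mat_prod)
  fix b assume "b \<in> set ks"
  then show "clifford_U n b \<in> carrier_mat (2 ^ n) (2 ^ n) \<and>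
      commute_up_to (if b \<noteq> a then - 1 else 1) (clifford_U n a) (clifford_U n b)"
    using assms clifford_U_anticommute[of a n b] clifford_U_carrier[of b n]
    by (auto simp: commute_up_to_def)
qed (use assms clifford_U_carrier in auto)

lemma cl_word_commute_clifford_U:
  assumes "a \<in> {1..2 * n + 1}" "set ks \<subseteq> {1..2 * n + 1}"
  shows "\<exists>e \<in> {1, - 1}. cl_word n ks * clifford_U n a = e \<cdot>\<^sub>m (clifford_U n a * cl_word n ks)"
proof -
  let ?e = "(- 1 :: complex) ^ length (filter (\<lambda>b. b \<noteq> a) ks)"
  have "commute_up_to ?e (cl_word n ks) (clifford_U n a)"
    by (rule commute_up_to_sym[OF clifford_U_commute_cl_word[OF assms]]) 
      (simp flip: power_add power2_eq_square power_mult)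
  moreover have "?e \<in> {1, - 1}" by (auto simp: minus_one_power_iff)
  ultimately show ?thesis by (auto simp: commute_up_to_def)
qed

text \<open>The adjoint reverses the word, and each letter is moved back at the cost of a sign. Only
  the fact that the total is 1 or -1 matters later.\<close>

lemma cl_word_adjoint:
  assumes "set ks \<subseteq> {1..2 * n + 1}"
  shows "\<exists>e \<in> {1, - 1}. mat_adjoint (cl_word n ks) = e \<cdot>\<^sub>m cl_word n ks"
  using assms
proof (induction ks)
  case Nil
  show ?case by (intro bexI[of _ 1]) auto
next
  case (Cons k ks)
  then obtain e where e: "e \<in> {1, - 1}" "mat_adjoint (cl_word n ks) = e \<cdot>\<^sub>m cl_word n ks"
    by (auto simp del: one_smult_mat)
  obtain e' where e': "e' \<in> {1, - 1}"
      "cl_word n ks * clifford_U n k = e' \<cdot>\<^sub>m (clifford_U n k * cl_word n ks)"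
    using cl_word_commute_clifford_U[of k n ks] Cons.prems by (auto simp del: one_smult_mat)
  have c: "clifford_U n k \<in> carrier_mat (2 ^ n) (2 ^ n)" "cl_word n ks \<in> carrier_mat (2 ^ n) (2 ^ n)"
    using Cons.prems by (auto intro!: clifford_U_carrier cl_word_carrier)
  have "mat_adjoint (cl_word n (k # ks)) = (e * e') \<cdot>\<^sub>m cl_word n (k # ks)"
    using Cons.prems c e e' clifford_U_adjoint[of k n]
    by (simp add: mat_adjoint_mult[of _ "2 ^ n" "2 ^ n" _ "2 ^ n"] mult_smult_assoc_mat[of _ "2 ^ n" "2 ^ n" _ "2 ^ n"])
  moreover have "e * e' \<in> {1, - 1}" using e e' by auto
  ultimately show ?case by blast
qed

text \<open>A letter selected by both Q and R is moved next to its twin and cancels. Subwords of one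
  list therefore multiply like symmetric differences, that is, like addition over F_2.\<close>

lemma cl_word_filter_mult:
  assumes "set ks \<subseteq> {1..2 * n + 1}"
  shows "\<exists>e \<in> {1, - 1}. cl_word n (filter Q ks) * cl_word n (filter R ks) =
           e \<cdot>\<^sub>m cl_word n (filter (\<lambda>k. Q k \<noteq> R k) ks)"
  using assms
proof (induction ks)
  case Nil
  show ?case by (intro bexI[of _ 1]) auto
next
  case (Cons k ks)
  let ?N = "2 ^ n :: nat" and ?X = "cl_word n (filter Q ks)" and ?Y = "cl_word n (filter R ks)"
    and ?Z = "cl_word n (filter (\<lambda>k. Q k \<noteq> R k) ks)" and ?U = "clifford_U n k"
  have c: "?U \<in> carrier_mat ?N ?N" "?X \<in> carrier_mat ?N ?N" "?Y \<in> carrier_mat ?N ?N" "?Z \<in> carrier_mat ?N ?N"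
    using Cons.prems by (auto intro!: clifford_U_carrier cl_word_carrier)
  have sq: "?U * ?U = 1\<^sub>m ?N" using Cons.prems clifford_U_square by auto
  note mat = assoc_mult_mat[of _ ?N ?N _ ?N _ ?N] mult_smult_assoc_mat[of _ ?N ?N _ ?N]
    mult_smult_distrib[of _ ?N ?N _ ?N]
  obtain e where e: "e \<in> {1, - 1}" "?X * ?Y = e \<cdot>\<^sub>m ?Z"
    using Cons by (auto simp del: one_smult_mat)
  obtain e' where e': "e' \<in> {1, - 1}" "?X * ?U = e' \<cdot>\<^sub>m (?U * ?X)"
    using cl_word_commute_clifford_U[of k n "filter Q ks"] Cons.prems by (auto simp del: one_smult_mat)
  have UU: "?U * (?U * M) = M" if "M \<in> carrier_mat ?N ?N" for M
    using that c sq by (metis mat(1) left_mult_one_mat)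
  have XUY: "?X * (?U * ?Y) = (e' * e) \<cdot>\<^sub>m (?U * ?Z)"
  proof -
    have "?X * (?U * ?Y) = (?X * ?U) * ?Y" using c by (simp add: mat)
    also have "\<dots> = e' \<cdot>\<^sub>m (?U * (?X * ?Y))" using c by (simp add: e' mat)
    finally show ?thesis using c by (simp add: e mat)
  qed
  have UXY: "?U * ?X * ?Y = e \<cdot>\<^sub>m (?U * ?Z)"
    using c by (simp add: mat e)
  have UXUY: "?U * ?X * (?U * ?Y) = (e' * e) \<cdot>\<^sub>m ?Z"
    using c by (simp add: mat XUY UU)
  have "e' * e \<in> {1, - 1}" using e e' by auto
  \<comment> \<open>The new letter may lie in neither subword, in one of them, or in both; in the
    last case it cancels by \<open>UXUY\<close>.\<close>
  then show ?case using e XUY UXY UXUY by (auto 4 3)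
qed

lemma cl_word_unitary:
  assumes "set ks \<subseteq> {1..2 * n + 1}"
  shows "mat_adjoint (cl_word n ks) * cl_word n ks = 1\<^sub>m (2 ^ n)"
  using assms
proof (induction ks)
  case (Cons k ks)
  let ?N = "2 ^ n :: nat"
  have c: "clifford_U n k \<in> carrier_mat ?N ?N" "cl_word n ks \<in> carrier_mat ?N ?N"
      "mat_adjoint (cl_word n ks) \<in> carrier_mat ?N ?N"
    using Cons.prems by (auto intro!: clifford_U_carrier cl_word_carrier mat_adjoint_carrier)
  have "mat_adjoint (cl_word n (k # ks)) * cl_word n (k # ks) =
      mat_adjoint (cl_word n ks) * ((clifford_U n k * clifford_U n k) * cl_word n ks)"
    using Cons.prems c clifford_U_adjoint[of k n]
    by (simp add: mat_adjoint_mult[of _ ?N ?N _ ?N] assoc_mult_mat[of _ ?N ?N _ ?N _ ?N])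
  with Cons c show ?case by (simp add: clifford_U_square)
qed simp

text \<open>A word M is unitary and its adjoint is e M with e = 1 or e = -1, so e M M = 1. A square
  root c of e, namely 1 or \<i>, makes c M a Hermitian involution.\<close>

lemma cl_word_hermitian:
  assumes "set ks \<subseteq> {1..2 * n + 1}"
  obtains c where "c \<noteq> 0" "mat_adjoint (c \<cdot>\<^sub>m cl_word n ks) = c \<cdot>\<^sub>m cl_word n ks"
    "(c \<cdot>\<^sub>m cl_word n ks) * (c \<cdot>\<^sub>m cl_word n ks) = 1\<^sub>m (2 ^ n)"
proof -
  let ?N = "2 ^ n :: nat" and ?M = "cl_word n ks"
  have M: "?M \<in> carrier_mat ?N ?N" using assms by (rule cl_word_carrier)
  obtain e where e: "e \<in> {1, - 1}" "mat_adjoint ?M = e \<cdot>\<^sub>m ?M"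
    using cl_word_adjoint[OF assms] by blast
  have sq: "e \<cdot>\<^sub>m (?M * ?M) = 1\<^sub>m ?N"
    using cl_word_unitary[OF assms] M by (simp add: e(2) mult_smult_assoc_mat[of _ ?N ?N _ ?N])
  define c where "c = (if e = 1 then 1 else \<i>)"
  show ?thesis
  proof (rule that)
    show "mat_adjoint (c \<cdot>\<^sub>m ?M) = c \<cdot>\<^sub>m ?M"
      using e by (auto simp: mat_adjoint_smult c_def)
    have "c * c = e" using e(1) by (auto simp: c_def)
    then show "(c \<cdot>\<^sub>m ?M) * (c \<cdot>\<^sub>m ?M) = 1\<^sub>m ?N"
      using M sq by (simp add: mult_smult_assoc_mat[of _ ?N ?N _ ?N] mult_smult_distrib[of _ ?N ?N _ ?N])
  qed (simp add: c_def)
qed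

subsection \<open>The Hamming labelling\<close>

lemma less_exp_iff_bits: "x < 2 ^ m \<longleftrightarrow> (\<forall>i. bit x i \<longrightarrow> i < m)" for x :: nat
  by (auto simp flip: take_bit_nat_eq_self_iff simp: bit_eq_iff bit_take_bit_iff)

text \<open>Flipping a bit is an involution without fixed points, so it sorts the elements of S into
  pairs.\<close>

lemma even_card_flip_bit:
  fixes S :: "nat set"
  assumes "finite S" and flip: "\<And>x. x \<in> S \<Longrightarrow> flip_bit l x \<in> S"
  shows "even (card S)"
proof -
  have flip2: "flip_bit l (flip_bit l x) = x" for x :: nat
    by (rule bit_eqI) (auto simp: bit_flip_bit_iff)
  have "bij_betw (flip_bit l) {x \<in> S. bit x l} {x \<in> S. \<not> bit x l}"
    by (rule bij_betw_byWitness[where f' = "flip_bit l"]) (auto simp: flip flip2 bit_flip_bit_iff)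
  then have "card {x \<in> S. bit x l} = card {x \<in> S. \<not> bit x l}"
    by (rule bij_betw_same_card)
  moreover have "card S = card {x \<in> S. bit x l} + card {x \<in> S. \<not> bit x l}"
    using assms(1) by (subst card_Un_disjoint[symmetric]) (auto intro: arg_cong[of _ _ card])
  ultimately show ?thesis by simp
qed

section \<open>The operators Gamma_x as words\<close>

text \<open>The order 1, n+1, 2, n+2, ... of the factors of Gamma_x. Up to its phase, Gamma_x is
  then the subword selected by x.\<close>

definition mode_order :: "nat \<Rightarrow> nat list" where
  "mode_order n = concat (map (\<lambda>k. [k, n + k]) [1..<n + 1])"

lemma set_mode_order: "set (mode_order n) = {1..2 * n}"
proof -
  have "set (mode_order n) = (\<Union>k\<in>{1..n}. {k, k + n})"
    unfolding mode_order_def set_concat set_map image_image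
    by (simp add: add.commute atLeastLessThanSuc_atLeastAtMost del: upt_Suc)
  also have "\<dots> = {1..n} \<union> (\<lambda>k. k + n) ` {1..n}"
    by blast
  finally have "set (mode_order n) = {1..n} \<union> (\<lambda>k. k + n) ` {1..n}" .
  moreover have "(\<lambda>k. k + n) ` {1..n} = {1 + n..n + n}"
    by (rule image_add_atLeastAtMost')
  moreover have "{1..n} \<union> {1 + n..n + n} = {1..2 * n}"
    by auto
  ultimately show ?thesis by simp
qed

lemma distinct_mode_order: "distinct (mode_order n)"
proof (rule card_distinct)
  have "length (concat (map (\<lambda>k. [k, n + k]) xs)) = 2 * length xs" for xs
    by (induction xs) auto
  then show "card (set (mode_order n)) = length (mode_order n)"
    by (simp add: set_mode_order) (simp add: mode_order_def)
qed

lemma length_filter_mode_order: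
  "length (filter Q (mode_order n)) = card {b \<in> {1..2 * n}. Q b}"
proof -
  have "length (filter Q (mode_order n)) = card (set (filter Q (mode_order n)))"
    using distinct_mode_order by (intro distinct_card[symmetric] distinct_filter)
  then show ?thesis by (simp add: set_mode_order)
qed

definition \<Gamma>_word :: "nat \<Rightarrow> bit vec \<Rightarrow> complex mat" where
  "\<Gamma>_word n x = cl_word n (filter (\<lambda>b. x $ (b - 1) = 1) (mode_order n))"

lemma clifford_\<Gamma>_eq: "clifford_\<Gamma> n x = \<i> ^ (wt x * (wt x - 1) div 2) \<cdot>\<^sub>m \<Gamma>_word n x"
proof -
  let ?Q = "\<lambda>b. x $ (b - 1) = 1" and ?N = "2 ^ n :: nat"
  have "mat_prod ?N (map (\<lambda>k. clifford_U n k ^\<^sub>m of_bool (x $ (k - 1) = 1)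
               * clifford_U n (n + k) ^\<^sub>m of_bool (x $ (n + k - 1) = 1)) ks) =
      cl_word n (filter ?Q (concat (map (\<lambda>k. [k, n + k]) ks)))" if "set ks \<subseteq> {1..n}" for ks
    using that
  proof (induction ks)
    case (Cons k ks)
    let ?W = "cl_word n (filter ?Q (concat (map (\<lambda>k. [k, n + k]) ks)))"
    have "?W \<in> carrier_mat ?N ?N"
      by (rule cl_word_carrier) (use Cons.prems in auto)
    moreover have "clifford_U n k \<in> carrier_mat ?N ?N" "clifford_U n (n + k) \<in> carrier_mat ?N ?N"
      by (rule clifford_U_carrier, use Cons.prems in auto)+
    ultimately show ?case
      using Cons by (simp add: assoc_mult_mat[of _ ?N ?N _ ?N _ ?N])
  qed simp
  note this[of "[1..<n + 1]"]
  moreover have "set [1..<n + 1] \<subseteq> {1..n}" by auto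
  ultimately show ?thesis
    by (simp add: clifford_\<Gamma>_def \<Gamma>_word_def mode_order_def del: upt_Suc)
qed

lemma \<Gamma>_word_carrier: "\<Gamma>_word n x \<in> carrier_mat (2 ^ n) (2 ^ n)"
  unfolding \<Gamma>_word_def by (rule cl_word_carrier) (auto simp: set_mode_order)

text \<open>Addition over F_2 is the symmetric difference of supports. The sign is its own inverse,
  so it can be put on either side.\<close>

lemma \<Gamma>_word_add:
  assumes "x \<in> carrier_vec (2 * n)" "y \<in> carrier_vec (2 * n)"
  shows "\<exists>e. \<Gamma>_word n (x + y) = e \<cdot>\<^sub>m (\<Gamma>_word n x * \<Gamma>_word n y)"
proof -
  have bit: "a + b = 1 \<longleftrightarrow> (a = 1) \<noteq> (b = 1)" for a b :: bit
    by (cases a; cases b) auto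
  have "filter (\<lambda>b. (x + y) $ (b - 1) = 1) (mode_order n) =
      filter (\<lambda>b. (x $ (b - 1) = 1) \<noteq> (y $ (b - 1) = 1)) (mode_order n)"
    by (rule filter_cong[OF refl]) (use assms in \<open>auto simp: set_mode_order bit simp del: add_bit_eq_xor\<close>)
  then obtain e where "e \<in> {1, - 1}" "\<Gamma>_word n x * \<Gamma>_word n y = e \<cdot>\<^sub>m \<Gamma>_word n (x + y)"
    using cl_word_filter_mult[of "mode_order n" n "\<lambda>b. x $ (b - 1) = 1" "\<lambda>b. y $ (b - 1) = 1"]
    by (auto simp: \<Gamma>_word_def set_mode_order simp del: one_smult_mat)
  then show ?thesis by (intro exI[of _ e]) auto
qed

section \<open>Parity of weights and the form q\<close>

lemma bit_add_eq_0_iff: "a + b = 0 \<longleftrightarrow> (a = 0 \<longleftrightarrow> b = 0)" for a b :: bit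
  by (cases a; cases b) auto

lemma bit_of_nat_eq_0_iff: "(of_nat k :: bit) = 0 \<longleftrightarrow> even k"
  by (induction k) (auto simp: bit_add_eq_0_iff simp del: add_bit_eq_xor)

text \<open>The parity of the weight is a linear functional over F_2, which is why q is additive
  although \<open>wt\<close> is not.\<close>

lemma even_wt_iff: "even (wt x) \<longleftrightarrow> (\<Sum>i<dim_vec x. x $ i) = 0" for x :: "bit vec"
proof -
  have "(\<Sum>i<dim_vec x. x $ i) = (\<Sum>i<dim_vec x. of_bool (x $ i \<noteq> 0))"
    by (intro sum.cong) (auto simp: of_bool_def)
  also have "\<dots> = of_nat (wt x)"
    by (simp add: wt_def sum.If_cases of_bool_def Collect_conj_eq lessThan_def)
  finally show ?thesis by (simp add: bit_of_nat_eq_0_iff)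
qed

lemma q_form_eq_0_iff: "q_form x y = 0 \<longleftrightarrow> (even (wt x * wt y) \<longleftrightarrow> x \<bullet> y = 0)"
  unfolding q_form_def bit_add_eq_0_iff bit_of_nat_eq_0_iff ..

lemma even_wt_add:
  fixes x y :: "bit vec"
  assumes "x \<in> carrier_vec m" "y \<in> carrier_vec m"
  shows "even (wt (x + y)) \<longleftrightarrow> (even (wt x) \<longleftrightarrow> even (wt y))"
proof -
  have "(\<Sum>i<m. (x + y) $ i) = (\<Sum>i<m. x $ i) + (\<Sum>i<m. y $ i)"
    using assms by (simp add: sum.distrib del: add_bit_eq_xor)
  then show ?thesis using assms by (simp add: even_wt_iff bit_add_eq_0_iff del: add_bit_eq_xor)
qed

lemma q_form_commute:
  assumes "x \<in> carrier_vec m" "y \<in> carrier_vec m"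
  shows "q_form x y = q_form y x"
  unfolding q_form_def comm_scalar_prod[OF assms] mult.commute[of "wt x"] ..

lemma q_form_add:
  assumes "x \<in> carrier_vec m" "y \<in> carrier_vec m" "z \<in> carrier_vec m"
    and "q_form x z = 0" "q_form y z = 0"
  shows "q_form (x + y) z = 0"
  using assms
  by (auto simp: q_form_eq_0_iff even_wt_add[of _ m] add_scalar_prod_distrib[of _ m] bit_add_eq_0_iff
      simp del: add_bit_eq_xor)

lemma q_form_zero:
  assumes "z \<in> carrier_vec m"
  shows "q_form (0\<^sub>v m) z = 0"
proof -
  have "even (wt (0\<^sub>v m :: bit vec))" by (simp add: even_wt_iff)
  then show ?thesis using assms by (simp add: q_form_eq_0_iff)
qed

lemma smult_bit_vec: "c \<cdot>\<^sub>v x = (if c = 1 then x else 0\<^sub>v (dim_vec x))" for c :: bit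
  by (cases c) auto

section \<open>The isotropic Hamming code C\<close>

text \<open>Here r stands for s + 1, so that the labels 1, ..., 2n+1 are the nonzero numbers of r
  bits. The bound on r makes room for the labels 4, 8 and 12 of the undetected word's
  partner.\<close>

locale clifford_hamming =
  fixes r n :: nat
  assumes r: "r \<ge> 4" and n: "2 * n + 2 = 2 ^ r"
begin

lemma full_mask: "2 * n + 1 = mask r"
  using n by (simp add: mask_eq_exp_minus_1)

lemma index_less: "b < 2 ^ r \<longleftrightarrow> b = 0 \<or> b \<in> {1..2 * n} \<or> b = mask r" for b
  using n full_mask by auto

lemma index_bits:
  assumes "b < 2 ^ r" "bit b i" "\<not> bit b j" "j < r"
  shows "b \<in> {1..2 * n}"
proof -
  have "b \<noteq> 0" using assms(2) by (cases "b = 0") auto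
  moreover have "b \<noteq> mask r" using assms(3,4) by (auto simp: bit_mask_iff)
  ultimately show ?thesis using assms(1) by (simp only: index_less) simp
qed

text \<open>Among all numbers of r bits that vanish on J, flipping the free bit l gives an even
  count. The all-ones label is not among them as J is nonempty, so dropping 0 leaves an odd number
  of coordinates.\<close>

lemma odd_card_zero_bits:
  assumes "J \<subseteq> {..<r}" "J \<noteq> {}" "l < r" "l \<notin> J"
  shows "odd (card {b \<in> {1..2 * n}. \<forall>j\<in>J. \<not> bit b j})"
proof -
  let ?S = "{b :: nat. b < 2 ^ r \<and> (\<forall>j\<in>J. \<not> bit b j)}"
  have "finite ?S" by (rule finite_subset[of _ "{..<2 ^ r}"]) auto
  then have "even (card ?S)"
    by (rule even_card_flip_bit[of _ l])
       (use assms in \<open>auto simp: less_exp_iff_bits bit_flip_bit_iff\<close>)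
  moreover have "?S = insert 0 {b \<in> {1..2 * n}. \<forall>j\<in>J. \<not> bit b j}"
  proof -
    have "\<not> (\<forall>j\<in>J. \<not> bit (mask r :: nat) j)" using assms(1,2) by (auto simp: bit_mask_iff)
    then have "x \<in> ?S \<longleftrightarrow> x \<in> insert 0 {b \<in> {1..2 * n}. \<forall>j\<in>J. \<not> bit b j}" for x
      using index_less[of x] by (cases "x = 0") auto
    then show ?thesis by blast
  qed
  ultimately show ?thesis by simp
qed

lemma odd_card_zero_bit: "j < r \<Longrightarrow> odd (card {b \<in> {1..2 * n}. \<not> bit b j})"
  using odd_card_zero_bits[of "{j}" "if j = 0 then 1 else 0"] r by (auto split: if_splits)

lemma ex_third: "\<exists>l<r. l \<noteq> i \<and> l \<noteq> j"
proof -
  define l where "l = (if 0 \<notin> {i, j} then 0 else if 1 \<notin> {i, j} then 1 else 2 :: nat)"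
  have "l < r" "l \<noteq> i" "l \<noteq> j" using r by (auto simp: l_def)
  then show ?thesis by blast
qed

lemma odd_card_zero_bit_pair:
  assumes "i < r" "j < r"
  shows "odd (card {b \<in> {1..2 * n}. \<not> bit b i \<and> \<not> bit b j})"
proof -
  obtain l where "l < r" "l \<noteq> i" "l \<noteq> j" using ex_third by blast
  then show ?thesis using odd_card_zero_bits[of "{i, j}" l] assms by auto
qed

text \<open>A difference of two odd counts: the labels with bit i clear, minus those with bit j
  clear as well. It decides whether two generators commute.\<close>

lemma even_card_bit_pair:
  assumes "i < r" "j < r"
  shows "even (card {b \<in> {1..2 * n}. \<not> bit b i \<and> bit b j})"
proof -
  have "{b \<in> {1..2 * n}. \<not> bit b i} =
      {b \<in> {1..2 * n}. \<not> bit b i \<and> bit b j} \<union> {b \<in> {1..2 * n}. \<not> bit b i \<and> \<not> bit b j}"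
    by auto
  then have "card {b \<in> {1..2 * n}. \<not> bit b i} =
      card {b \<in> {1..2 * n}. \<not> bit b i \<and> bit b j} + card {b \<in> {1..2 * n}. \<not> bit b i \<and> \<not> bit b j}"
    by (subst card_Un_disjoint[symmetric]) auto
  then show ?thesis
    using odd_card_zero_bit[OF assms(1)] odd_card_zero_bit_pair[OF assms] by (simp only: even_add) blast
qed

text \<open>Coordinate i of a vector belongs to the label i + 1, hence \<open>Suc i\<close>.\<close>

definition gen :: "nat \<Rightarrow> bit vec" where
  "gen j = vec (2 * n) (\<lambda>i. of_bool (\<not> bit (Suc i) j))"

lemma gen_carrier [simp]: "gen j \<in> carrier_vec (2 * n)"
  by (simp add: gen_def)

lemma gen_dim [simp]: "dim_vec (gen j) = 2 * n"
  by (simp add: gen_def)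

lemma gen_index: "i < 2 * n \<Longrightarrow> gen j $ i = of_bool (\<not> bit (Suc i) j)"
  by (simp add: gen_def)

lemma sum_bit_eq_card: "(\<Sum>i<2 * n. of_bool (Q (Suc i)) :: bit) = of_nat (card {b \<in> {1..2 * n}. Q b})"
proof -
  have "(\<Sum>i<2 * n. of_bool (Q (Suc i)) :: bit) = (\<Sum>b\<in>{1..2 * n}. of_bool (Q b))"
    using sum.atLeast1_atMost_eq[of "\<lambda>b. of_bool (Q b) :: bit" "2 * n"] by (simp only: One_nat_def)
  also have "\<dots> = of_nat (card {b \<in> {1..2 * n}. Q b})"
    by (simp add: of_bool_def sum.If_cases Int_def)
  finally show ?thesis .
qed

lemma odd_wt_gen:
  assumes "j < r"
  shows "odd (wt (gen j))"
proof -
  have "(\<Sum>i<2 * n. gen j $ i) = (\<Sum>i<2 * n. of_bool (\<not> bit (Suc i) j))"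
    by (intro sum.cong refl gen_index) simp
  also have "\<dots> = of_nat (card {b \<in> {1..2 * n}. \<not> bit b j})"
    by (rule sum_bit_eq_card)
  finally show ?thesis
    using odd_card_zero_bit[OF assms] by (simp only: even_wt_iff gen_dim bit_of_nat_eq_0_iff) simp
qed

text \<open>Both terms of q equal 1: the weights are odd, and so is the size of the common
  support.\<close>

lemma q_form_gen:
  assumes "i < r" "j < r"
  shows "q_form (gen i) (gen j) = 0"
proof -
  have "gen i \<bullet> gen j = (\<Sum>k<2 * n. of_bool (\<not> bit (Suc k) i \<and> \<not> bit (Suc k) j))"
    by (auto simp: scalar_prod_def gen_index atLeast0LessThan intro!: sum.cong)
  then have "gen i \<bullet> gen j \<noteq> 0"
    using odd_card_zero_bit_pair[OF assms]
    by (simp only: sum_bit_eq_card[of "\<lambda>b. \<not> bit b i \<and> \<not> bit b j"] bit_of_nat_eq_0_iff) simp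
  then show ?thesis using odd_wt_gen assms by (simp add: q_form_eq_0_iff)
qed

definition code_gens :: "bit mat" where
  "code_gens = mat_of_cols (2 * n) (map gen [0..<r])"

definition code :: "bit vec set" where
  "code = LinearCombinations.module.span class_ring (module_vec TYPE(bit) (2 * n)) (gen ` {..<r})"

text \<open>The witness is the all-ones label with bit l flipped. At its coordinate
  \<open>gen l\<close> is the only nonzero generator, which separates the generators and proves them
  independent.\<close>

lemma ex_only_zero_bit:
  assumes "l < r"
  shows "\<exists>a<2 * n. \<forall>j<r. bit (Suc a) j \<longleftrightarrow> j \<noteq> l"
proof -
  \<comment> \<open>A second position, where the bit stays set, keeps the label from being
    0.\<close>
  obtain i where i: "i < r" "i \<noteq> l" using ex_third by blast
  define a :: nat where "a = flip_bit l (mask r)"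
  have bit: "bit a j \<longleftrightarrow> j < r \<and> j \<noteq> l" for j
    using assms by (auto simp: a_def bit_flip_bit_iff bit_mask_iff)
  then have "a < 2 ^ r" by (simp add: less_exp_iff_bits)
  then have "a \<in> {1..2 * n}"
    using index_bits[of a i l] i assms bit by blast
  then obtain b where "a = Suc b" "b < 2 * n" by (cases a) auto
  then show ?thesis using bit by blast
qed

lemma code_subspace: "vec_subspace (2 * n) code"
  and code_dim: "subspace_dim (2 * n) code = r"
  and code_carrier: "x \<in> code \<Longrightarrow> x \<in> carrier_vec (2 * n)"
  and gen_code: "j < r \<Longrightarrow> gen j \<in> code"
proof -
  interpret vec_space "TYPE(bit)" "2 * n" .
  have S: "gen ` {..<r} \<subseteq> carrier_vec (2 * n)" by auto
  show "vec_subspace (2 * n) code"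
    unfolding code_def using span_is_subspace S by simp
  show "x \<in> code \<Longrightarrow> x \<in> carrier_vec (2 * n)"
    unfolding code_def using span_closed S by simp
  show "j < r \<Longrightarrow> gen j \<in> code"
    unfolding code_def using span_mem[of "gen ` {..<r}"] S by auto
  have A: "code_gens \<in> carrier_mat (2 * n) r"
    using mat_of_cols_carrier(1)[of "2 * n" "map gen [0..<r]"] by (simp add: code_gens_def)
  have cols: "cols code_gens = map gen [0..<r]"
    unfolding code_gens_def by (rule cols_mat_of_cols) auto
  have inj: "gen i \<noteq> gen j" if "i < r" "j < r" "i \<noteq> j" for i j
    using ex_only_zero_bit[OF that(1)] that by (metis gen_index of_bool_eq_iff)
  have "inj_on gen {..<r}"
    by (rule inj_onI, rule ccontr) (use inj in auto)
  then have dist: "distinct (cols code_gens)"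
    by (simp add: cols distinct_map atLeast0LessThan)
  have "lin_indpt (set (cols code_gens))"
  proof
    assume "lin_dep (set (cols code_gens))"
    then obtain v where v: "v \<in> carrier_vec r" "v \<noteq> 0\<^sub>v r" "code_gens *\<^sub>v v = 0\<^sub>v (2 * n)"
      using lin_depE[OF A _ dist] by blast
    have "v $ l = 0" if l: "l < r" for l
    proof -
      obtain a where a: "a < 2 * n" "\<And>j. j < r \<Longrightarrow> bit (Suc a) j \<longleftrightarrow> j \<noteq> l"
        using ex_only_zero_bit[OF l] by blast
      \<comment> \<open>Coordinate a of a vanishing combination retains the coefficient of
        \<open>gen l\<close> alone.\<close>
      have "0 = (code_gens *\<^sub>v v) $ a" using v a by simp
      also have "\<dots> = (\<Sum>j<r. gen j $ a * v $ j)"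
      proof -
        have "row code_gens a = vec r (\<lambda>j. gen j $ a)"
          using A a(1) by (intro eq_vecI) (auto simp: code_gens_def mat_of_cols_index)
        then show ?thesis
          using v(1) A a(1) by (simp add: scalar_prod_def atLeast0LessThan del: mult_bit_eq_and)
      qed
      also have "\<dots> = (\<Sum>j<r. if j = l then v $ j else 0)"
        using a by (intro sum.cong) (auto simp: gen_index)
      also have "\<dots> = v $ l" using l by simp
      finally show ?thesis by simp
    qed
    then show False using v by (metis carrier_vecD eq_vecI index_zero_vec)
  qed
  then have "rank code_gens = r" using lin_indpt_full_rank[OF A dist] by simp
  moreover have "set (cols code_gens) = gen ` {..<r}" by (simp add: cols atLeast0LessThan)
  ultimately show "subspace_dim (2 * n) code = r"
    by (simp add: subspace_dim_def code_def rank_def)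
qed

text \<open>Over F_2 a scalar multiple is the vector itself or zero, so no case for scalars
  remains.\<close>

lemma code_induct [consumes 1, case_names zero gen add]:
  assumes "x \<in> code"
    and "Q (0\<^sub>v (2 * n))" and "\<And>j. j < r \<Longrightarrow> Q (gen j)"
    and add: "\<And>x y. x \<in> carrier_vec (2 * n) \<Longrightarrow> y \<in> carrier_vec (2 * n) \<Longrightarrow> Q x \<Longrightarrow> Q y \<Longrightarrow> Q (x + y)"
  shows "Q x"
proof -
  interpret vec_space "TYPE(bit)" "2 * n" .
  show ?thesis
    using assms(1) unfolding code_def
    by (induction rule: span_induct) (use assms(2-4) in \<open>auto simp: smult_bit_vec\<close>)
qed

text \<open>Bilinearity reduces the claim to generators, one argument at a time; symmetry of q
  exchanges the arguments between the two inductions.\<close>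

lemma code_isotropic: "q_isotropic n code"
proof -
  have q_gen: "q_form x (gen j) = 0" if "x \<in> code" "j < r" for x j
    using that(1)
  proof (induction rule: code_induct)
    case (gen i)
    then show ?case using q_form_gen that(2) by blast
  next
    case (add x y)
    then show ?case by (intro q_form_add[of _ "2 * n"] gen_carrier)
  qed (rule q_form_zero[OF gen_carrier])
  have "q_form y x = 0" if x: "x \<in> code" and y: "y \<in> code" for x y
    using y
  proof (induction rule: code_induct)
    case (gen j)
    then show ?case
      using q_form_commute[OF gen_carrier code_carrier[OF x]] q_gen[OF x] by simp
  next
    case (add y z)
    then show ?case by (intro q_form_add[of _ "2 * n"] code_carrier[OF x])
  qed (rule q_form_zero[OF code_carrier[OF x]])
  then show ?thesis using code_subspace by (simp add: q_isotropic_def)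
qed

end

subsection \<open>The code space and its distance\<close>

lemma set_filter_mode_order: "set (filter Q (mode_order n)) \<subseteq> {1..2 * n + 1}"
  by (auto simp: set_mode_order)

lemma mult_mat_zero_vec: "A \<in> carrier_mat a b \<Longrightarrow> A *\<^sub>v 0\<^sub>v b = 0\<^sub>v a"
  by (intro eq_vecI) auto

lemma smult_vec_cancel_left:
  fixes v w :: "'a :: field vec"
  assumes "c \<cdot>\<^sub>v v = c \<cdot>\<^sub>v w" "c \<noteq> 0"
  shows "v = w"
proof -
  have "inverse c \<cdot>\<^sub>v (c \<cdot>\<^sub>v v) = inverse c \<cdot>\<^sub>v (c \<cdot>\<^sub>v w)" using assms(1) by simp
  then show ?thesis using assms(2) by (simp add: smult_smult_assoc)
qed

lemma smult_vec_cancel_right: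
  fixes v :: "'a :: field vec"
  assumes "c \<cdot>\<^sub>v v = d \<cdot>\<^sub>v v" "v \<noteq> 0\<^sub>v (dim_vec v)"
  shows "c = d"
proof -
  obtain i where i: "i < dim_vec v" "v $ i \<noteq> 0"
    using assms(2) by (metis eq_vecI index_zero_vec)
  have "(c \<cdot>\<^sub>v v) $ i = (d \<cdot>\<^sub>v v) $ i" by (simp add: assms(1))
  then show ?thesis using i by simp
qed

context clifford_hamming
begin

lemma \<Gamma>_word_gen: "\<Gamma>_word n (gen j) = cl_word n (filter (\<lambda>b. \<not> bit b j) (mode_order n))"
  unfolding \<Gamma>_word_def
  by (intro arg_cong[of _ _ "cl_word n"] filter_cong refl) (auto simp: set_mode_order gen_index)

lemma clifford_U_commute_gen:
  assumes a: "a \<in> {1..2 * n + 1}" and j: "j < r"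
  shows "commute_up_to (if bit a j then - 1 else 1) (clifford_U n a) (\<Gamma>_word n (gen j))"
proof -
  let ?S = "{b \<in> {1..2 * n}. \<not> bit b j}"
  have "length (filter (\<lambda>b. b \<noteq> a) (filter (\<lambda>b. \<not> bit b j) (mode_order n))) = card (?S - {a})"
    unfolding filter_filter length_filter_mode_order by (rule arg_cong[of _ _ card]) blast
  moreover have "even (card (?S - {a})) \<longleftrightarrow> \<not> bit a j"
  proof (cases "bit a j")
    case True
    then have "?S - {a} = ?S" by blast
    then show ?thesis using odd_card_zero_bit[OF j] True by simp
  next
    case False
    \<comment> \<open>The label 2n+1 has every bit below r set, so a clear bit j places a among the
      coordinates.\<close>
    have "a \<noteq> 2 * n + 1" using False j unfolding full_mask by (auto simp: bit_mask_iff)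
    then have "a \<in> ?S" using a False by simp
    then have "card ?S = Suc (card (?S - {a}))" by (intro card.remove) auto
    then show ?thesis using odd_card_zero_bit[OF j] False by simp
  qed
  ultimately show ?thesis
    using clifford_U_commute_cl_word[OF a set_filter_mode_order[of "\<lambda>b. \<not> bit b j"]]
    unfolding \<Gamma>_word_gen by (simp only: minus_one_power_iff) (simp split: if_splits)
qed

text \<open>Modulo 2 the exponent is bit j of the XOR of the labels, the j-th entry of the
  syndrome.\<close>

lemma gen_commute_cl_word:
  assumes ks: "set ks \<subseteq> {1..2 * n + 1}" and j: "j < r"
  shows "commute_up_to ((- 1) ^ length (filter (\<lambda>a. bit a j) ks)) (\<Gamma>_word n (gen j)) (cl_word n ks)"
  unfolding cl_word_def prod_list_minus_one[symmetric]
proof (rule commute_up_to_mat_prod[OF \<Gamma>_word_carrier], intro conjI)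
  fix a assume "a \<in> set ks"
  then have a: "a \<in> {1..2 * n + 1}" using ks by blast
  then show "clifford_U n a \<in> carrier_mat (2 ^ n) (2 ^ n)" by (rule clifford_U_carrier)
  show "commute_up_to (if bit a j then - 1 else 1) (\<Gamma>_word n (gen j)) (clifford_U n a)"
    using commute_up_to_sym[OF clifford_U_commute_gen[OF a j]] by simp
qed

text \<open>The word of \<open>gen j\<close> has a syndrome too: its sign against
  \<open>gen i\<close> counts the letters with bit j clear and bit i set, an even number.\<close>

lemma gen_commute_gen:
  assumes "i < r" "j < r"
  shows "\<Gamma>_word n (gen i) * \<Gamma>_word n (gen j) = \<Gamma>_word n (gen j) * \<Gamma>_word n (gen i)"
proof -
  have "even (length (filter (\<lambda>a. bit a i) (filter (\<lambda>b. \<not> bit b j) (mode_order n))))"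
    unfolding filter_filter length_filter_mode_order using even_card_bit_pair[OF assms(2,1)] .
  then show ?thesis
    using gen_commute_cl_word[OF set_filter_mode_order assms(1), of "\<lambda>b. \<not> bit b j"]
    unfolding commute_up_to_def \<Gamma>_word_gen[of j] by simp
qed

section \<open>Normalized stabilizers and the code space\<close>

text \<open>Being a Hermitian involution determines the scalar up to sign, and the sign merely
  selects which joint eigenspace becomes the code.\<close>

definition phase :: "nat \<Rightarrow> complex" where
  "phase j = (SOME c. c \<noteq> 0 \<and>
     mat_adjoint (c \<cdot>\<^sub>m \<Gamma>_word n (gen j)) = c \<cdot>\<^sub>m \<Gamma>_word n (gen j) \<and>
     (c \<cdot>\<^sub>m \<Gamma>_word n (gen j)) * (c \<cdot>\<^sub>m \<Gamma>_word n (gen j)) = 1\<^sub>m (2 ^ n))"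

definition stab :: "nat \<Rightarrow> complex mat" where
  "stab j = phase j \<cdot>\<^sub>m \<Gamma>_word n (gen j)"

lemma stab_carrier: "stab j \<in> carrier_mat (2 ^ n) (2 ^ n)"
  unfolding stab_def by (rule smult_carrier_mat[OF \<Gamma>_word_carrier])

lemma phase_nonzero: "phase j \<noteq> 0"
  and stab_adjoint: "mat_adjoint (stab j) = stab j"
  and stab_square: "stab j * stab j = 1\<^sub>m (2 ^ n)"
proof -
  have "\<exists>c. c \<noteq> 0 \<and>
     mat_adjoint (c \<cdot>\<^sub>m \<Gamma>_word n (gen j)) = c \<cdot>\<^sub>m \<Gamma>_word n (gen j) \<and>
     (c \<cdot>\<^sub>m \<Gamma>_word n (gen j)) * (c \<cdot>\<^sub>m \<Gamma>_word n (gen j)) = 1\<^sub>m (2 ^ n)"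
    unfolding \<Gamma>_word_gen
    using cl_word_hermitian[OF set_filter_mode_order] by metis
  from someI_ex[OF this] show "phase j \<noteq> 0" "mat_adjoint (stab j) = stab j" "stab j * stab j = 1\<^sub>m (2 ^ n)"
    unfolding stab_def phase_def by blast+
qed

lemma stab_commute_cl_word:
  assumes ks: "set ks \<subseteq> {1..2 * n + 1}" and j: "j < r"
  shows "stab j * cl_word n ks = (- 1) ^ length (filter (\<lambda>a. bit a j) ks) \<cdot>\<^sub>m (cl_word n ks * stab j)"
  using gen_commute_cl_word[OF assms] \<Gamma>_word_carrier[of n "gen j"] cl_word_carrier[OF ks]
  by (simp add: commute_up_to_def stab_def mult_smult_assoc_mat[of _ "2 ^ n" "2 ^ n" _ "2 ^ n"]
      mult_smult_distrib[of _ "2 ^ n" "2 ^ n" _ "2 ^ n"] mult.commute)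

lemma stab_commute:
  assumes "i < r" "j < r"
  shows "stab i * stab j = stab j * stab i"
  using gen_commute_gen[OF assms] \<Gamma>_word_carrier[of n]
  by (simp add: stab_def mult_smult_assoc_mat[of _ "2 ^ n" "2 ^ n" _ "2 ^ n"]
      mult_smult_distrib[of _ "2 ^ n" "2 ^ n" _ "2 ^ n"] mult.commute)

text \<open>It makes n - r a true difference, so that halving 2 ^ n r times gives 2 ^ (n -
  r).\<close>

lemma r_le_n: "r \<le> n"
proof -
  have "2 * m + 2 \<le> 2 ^ m" if "m \<ge> 4" for m :: nat
    using that by (induction m rule: dec_induct) auto
  from this[OF r] show ?thesis using n by simp
qed

definition code_space :: "complex vec set" where
  "code_space = {v \<in> carrier_vec (2 ^ n). \<forall>j<r. stab j *\<^sub>v v = v}"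

lemma ex_code_projection:
  obtains P where "orthogonal_projection (2 ^ n) code_space P" "mat_trace P = 2 ^ (n - r)"
    "\<And>j. j < r \<Longrightarrow> stab j * P = P" "\<And>j. j < r \<Longrightarrow> P * stab j = P"
proof -
  let ?N = "2 ^ n :: nat"
  have exp: "2 ^ j \<in> {1..2 * n + 1}" if "j < r" for j
  proof -
    have "(2 :: nat) ^ j < 2 * n + 2" unfolding n using that by simp
    then show ?thesis by simp
  qed
  have "\<exists>P \<in> carrier_mat ?N ?N. mat_adjoint P = P \<and> P * P = P \<and> (\<forall>j<r. stab j * P = P) \<and>
           (\<forall>v \<in> carrier_vec ?N. (\<forall>j<r. stab j *\<^sub>v v = v) \<longrightarrow> P *\<^sub>v v = v) \<and>
           (\<forall>X \<in> carrier_mat ?N ?N. (\<forall>j<r. X * stab j = stab j * X) \<longrightarrow> X * P = P * X) \<and>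
           mat_trace P = of_nat ?N / 2 ^ r"
  \<comment> \<open>The label 2 ^ j has only bit j set, so U with this label anticommutes with
    \<open>stab j\<close> and commutes with the other stabilizers.\<close>
  proof (rule stabilizer_projection[where F = "\<lambda>j. clifford_U n (2 ^ j)"])
    fix i j assume ij: "i < r" "j < r"
    show "commute_up_to (if i = j then - 1 else 1) (clifford_U n (2 ^ i)) (stab j)"
      unfolding stab_def
      by (rule commute_up_to_smult[OF clifford_U_carrier \<Gamma>_word_carrier])
         (use exp clifford_U_commute_gen[OF exp ij(2), of i] ij in \<open>auto simp: bit_exp_iff\<close>)
  qed (use exp in \<open>auto intro: stab_carrier clifford_U_carrier stab_adjoint stab_square clifford_U_square stab_commute\<close>)
  then obtain P where P: "P \<in> carrier_mat ?N ?N" "mat_adjoint P = P" "P * P = P"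
      and stab: "\<And>j. j < r \<Longrightarrow> stab j * P = P"
      and fix_P: "\<And>v. v \<in> carrier_vec ?N \<Longrightarrow> (\<And>j. j < r \<Longrightarrow> stab j *\<^sub>v v = v) \<Longrightarrow> P *\<^sub>v v = v"
      and tr: "mat_trace P = of_nat ?N / 2 ^ r"
    by blast
  show ?thesis
  proof (rule that)
    have "(\<lambda>v. P *\<^sub>v v) ` carrier_vec ?N = code_space"
    proof (intro equalityI subsetI)
      fix w assume "w \<in> (\<lambda>v. P *\<^sub>v v) ` carrier_vec ?N"
      then obtain v where v: "v \<in> carrier_vec ?N" "w = P *\<^sub>v v" by blast
      have "stab j *\<^sub>v w = w" if "j < r" for j
        using stab[OF that] v P(1) stab_carrier by (metis assoc_mult_mat_vec)
      then show "w \<in> code_space"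
        using v P(1) by (simp add: code_space_def)
    next
      fix w assume "w \<in> code_space"
      then show "w \<in> (\<lambda>v. P *\<^sub>v v) ` carrier_vec ?N"
        using fix_P[of w] by (intro image_eqI[of _ _ w]) (auto simp: code_space_def)
    qed
    then show "orthogonal_projection ?N code_space P"
      using P by (simp add: orthogonal_projection_def)
    show "mat_trace P = 2 ^ (n - r)"
      using tr r_le_n by (simp add: power_diff)
    show "stab j * P = P" if "j < r" for j
      using stab[OF that] .
    \<comment> \<open>The adjoint of \<open>stab j * P = P\<close>, in which both factors are
      Hermitian.\<close>
    show "P * stab j = P" if "j < r" for j
      using arg_cong[OF stab[OF that], of mat_adjoint] mat_adjoint_mult[OF stab_carrier P(1), of j] P(2)
      by (simp add: stab_adjoint)
  qed
qed

text \<open>The code space is the column space of its projection, so its dimension is a rank and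
  hence a trace.\<close>

lemma code_space_subspace: "vec_subspace (2 ^ n) code_space"
  and code_space_dim: "subspace_dim (2 ^ n) code_space = 2 ^ (n - r)"
proof -
  let ?N = "2 ^ n :: nat"
  interpret vec_space "TYPE(complex)" ?N .
  obtain P where P: "orthogonal_projection ?N code_space P" "mat_trace P = 2 ^ (n - r)"
    by (rule ex_code_projection)
  have carrier: "P \<in> carrier_mat ?N ?N" and im: "(\<lambda>v. P *\<^sub>v v) ` carrier_vec ?N = code_space"
    and idem: "P * P = P"
    using P(1) by (auto simp: orthogonal_projection_def)
  have "col_space P = code_space"
    using col_space_eq[OF carrier] carrier im[symmetric] by auto
  then have W: "span (set (cols P)) = code_space"
    by (simp add: col_space_def)
  have S: "set (cols P) \<subseteq> carrier_vec ?N" using cols_dim[of P] carrier by simp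
  show "vec_subspace ?N code_space"
    using span_is_subspace[of "set (cols P)"] S W by simp
  have "of_nat (rank P) = (of_nat (2 ^ (n - r)) :: complex)"
    using rank_idempotent[OF carrier idem] P(2) by simp
  then have "rank P = 2 ^ (n - r)" by (simp only: of_nat_eq_iff)
  then show "subspace_dim ?N code_space = 2 ^ (n - r)"
    by (simp add: subspace_dim_def rank_def W)
qed

lemma code_space_nonzero: "code_space \<noteq> {0\<^sub>v (2 ^ n)}"
proof
  let ?N = "2 ^ n :: nat"
  assume *: "code_space = {0\<^sub>v ?N}"
  obtain P where P: "orthogonal_projection ?N code_space P" "mat_trace P = 2 ^ (n - r)"
    by (rule ex_code_projection)
  have carrier: "P \<in> carrier_mat ?N ?N" and im: "(\<lambda>v. P *\<^sub>v v) ` carrier_vec ?N = code_space"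
    using P(1) by (auto simp: orthogonal_projection_def)
  have "P $$ (i, i) = 0" if "i < ?N" for i
  proof -
    have "P *\<^sub>v unit_vec ?N i = 0\<^sub>v ?N" using im * by auto
    then have "(P *\<^sub>v unit_vec ?N i) $ i = 0" using that by simp
    then show ?thesis using carrier that by (simp add: scalar_prod_right_unit)
  qed
  then have "mat_trace P = 0" using carrier by (simp add: mat_trace_def)
  then show False using P(2) by simp
qed

lemma ex_nonzero_code_space:
  obtains w where "w \<in> code_space" "w \<noteq> 0\<^sub>v (2 ^ n)"
proof -
  have "0\<^sub>v (2 ^ n) \<in> code_space"
    using mult_mat_zero_vec[OF stab_carrier] by (simp add: code_space_def)
  then show ?thesis using code_space_nonzero that by blast
qed

text \<open>Generators act on the code as scalars, and a sum in C acts as a product up to a factor.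
  The scalar is chosen before v: the whole code lies in one eigenspace.\<close>

lemma \<Gamma>_word_code_space:
  assumes "x \<in> code"
  shows "\<exists>c. \<forall>v \<in> code_space. \<Gamma>_word n x *\<^sub>v v = c \<cdot>\<^sub>v v"
  using assms
proof (induction rule: code_induct)
  case zero
  have "filter (\<lambda>b. 0\<^sub>v (2 * n) $ (b - 1) = (1 :: bit)) (mode_order n) = []"
    by (auto simp: filter_empty_conv set_mode_order)
  then have "\<Gamma>_word n (0\<^sub>v (2 * n)) = 1\<^sub>m (2 ^ n)" by (simp add: \<Gamma>_word_def)
  then show ?case by (intro exI[of _ 1]) (auto simp: code_space_def)
next
  case (gen j)
  have "\<Gamma>_word n (gen j) = (1 / phase j) \<cdot>\<^sub>m stab j"
    using phase_nonzero[of j] by (simp add: stab_def)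
  then show ?case
    using gen stab_carrier[of j]
    by (intro exI[of _ "1 / phase j"]) (auto simp: code_space_def smult_mat_mult_vec)
next
  case (add x y)
  then obtain a b where ab: "\<And>v. v \<in> code_space \<Longrightarrow> \<Gamma>_word n x *\<^sub>v v = a \<cdot>\<^sub>v v"
      "\<And>v. v \<in> code_space \<Longrightarrow> \<Gamma>_word n y *\<^sub>v v = b \<cdot>\<^sub>v v" by blast
  obtain e where e: "\<Gamma>_word n (x + y) = e \<cdot>\<^sub>m (\<Gamma>_word n x * \<Gamma>_word n y)"
    using \<Gamma>_word_add add by blast
  have "\<Gamma>_word n (x + y) *\<^sub>v v = (e * (b * a)) \<cdot>\<^sub>v v" if v: "v \<in> code_space" for v
  proof -
    have vc: "v \<in> carrier_vec (2 ^ n)" using v by (simp add: code_space_def)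
    have "\<Gamma>_word n (x + y) *\<^sub>v v = e \<cdot>\<^sub>v (\<Gamma>_word n x *\<^sub>v (\<Gamma>_word n y *\<^sub>v v))"
      using vc \<Gamma>_word_carrier[of n x] \<Gamma>_word_carrier[of n y] unfolding e
      by (subst smult_mat_mult_vec) (auto simp: assoc_mult_mat_vec[of _ "2 ^ n" "2 ^ n" _ "2 ^ n"])
    also have "\<dots> = e \<cdot>\<^sub>v (b \<cdot>\<^sub>v (a \<cdot>\<^sub>v v))"
      using v vc by (simp add: ab mult_mat_vec[OF \<Gamma>_word_carrier vc])
    finally show ?thesis by (simp add: smult_smult_assoc)
  qed
  then show ?case by blast
qed

text \<open>The code is cut out by r normalized generators, the eigenspace by a condition for every
  x in C. On the code each operator is a scalar, which defines \<chi>; conversely a nonzero code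
  vector w pins the value of \<chi> at \<open>gen j\<close>, and the eigenvalue equation there says
  again that \<open>stab j\<close> fixes v.\<close>

lemma code_space_eigenspace: "simultaneous_eigenspace n code code_space"
proof -
  let ?N = "2 ^ n :: nat"
  have "\<exists>c. \<forall>v \<in> code_space. clifford_\<Gamma> n x *\<^sub>v v = c \<cdot>\<^sub>v v" if x: "x \<in> code" for x
  proof -
    obtain c where c: "\<And>v. v \<in> code_space \<Longrightarrow> \<Gamma>_word n x *\<^sub>v v = c \<cdot>\<^sub>v v"
      using \<Gamma>_word_code_space[OF x] by blast
    let ?d = "\<i> ^ (wt x * (wt x - 1) div 2)"
    have "clifford_\<Gamma> n x *\<^sub>v v = (?d * c) \<cdot>\<^sub>v v" if v: "v \<in> code_space" for v
    proof -
      have "v \<in> carrier_vec (dim_col (\<Gamma>_word n x))"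
        using v \<Gamma>_word_carrier[of n x] by (simp add: code_space_def)
      then show ?thesis unfolding clifford_\<Gamma>_eq by (simp add: smult_mat_mult_vec c v smult_smult_assoc)
    qed
    then show ?thesis by blast
  qed
  then obtain \<chi> where \<chi>: "\<And>x v. x \<in> code \<Longrightarrow> v \<in> code_space \<Longrightarrow> clifford_\<Gamma> n x *\<^sub>v v = \<chi> x \<cdot>\<^sub>v v"
    by metis
  obtain w where w: "w \<in> code_space" "w \<noteq> 0\<^sub>v ?N"
    by (rule ex_nonzero_code_space)
  have eq: "code_space = {v \<in> carrier_vec ?N. \<forall>x\<in>code. clifford_\<Gamma> n x *\<^sub>v v = \<chi> x \<cdot>\<^sub>v v}" (is "_ = ?R")
  proof (intro equalityI subsetI)
    fix v assume "v \<in> code_space"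
    then show "v \<in> ?R" using \<chi> by (simp add: code_space_def)
  next
    fix v assume v: "v \<in> ?R"
    have "stab j *\<^sub>v v = v" if j: "j < r" for j
    proof -
      \<comment> \<open>The ratio between the prescribed phase of Gamma and the phase chosen for
        \<open>stab j\<close>.\<close>
      define d where "d = \<i> ^ (wt (gen j) * (wt (gen j) - 1) div 2) / phase j"
      have d: "d \<noteq> 0" using phase_nonzero by (simp add: d_def)
      have "clifford_\<Gamma> n (gen j) = d \<cdot>\<^sub>m stab j"
        using phase_nonzero[of j] by (simp add: clifford_\<Gamma>_eq stab_def d_def)
      then have \<Gamma>: "clifford_\<Gamma> n (gen j) *\<^sub>v u = d \<cdot>\<^sub>v (stab j *\<^sub>v u)" if "u \<in> carrier_vec ?N" for u
        using that stab_carrier[of j] by (simp add: smult_mat_mult_vec)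
      have wc: "w \<in> carrier_vec ?N" "stab j *\<^sub>v w = w"
        using w(1) j by (auto simp: code_space_def)
      have "\<chi> (gen j) \<cdot>\<^sub>v w = d \<cdot>\<^sub>v w"
        using \<chi>[OF gen_code[OF j] w(1)] \<Gamma>[OF wc(1)] wc(2) by simp
      then have "\<chi> (gen j) = d"
        by (rule smult_vec_cancel_right) (use w(2) wc in auto)
      then have "d \<cdot>\<^sub>v (stab j *\<^sub>v v) = d \<cdot>\<^sub>v v"
        using v \<Gamma>[of v] gen_code[OF j] by auto
      then show ?thesis using d by (rule smult_vec_cancel_left)
    qed
    then show "v \<in> code_space" using v by (simp add: code_space_def)
  qed
  show ?thesis
    unfolding simultaneous_eigenspace_def by (intro conjI exI[of _ \<chi>] eq code_space_nonzero)
qed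

section \<open>Detection of words of length at most two\<close>

text \<open>P E P is linear in E, so words suffice. The empty word gives P and the others give 0.
  The bound 2 is d - 1 for distance 3.\<close>

lemma clifford_metric_detects:
  assumes m: "m \<le> 2 * n + 1" and E: "E \<in> clifford_metric n m 2"
  shows "detects (2 ^ n) code_space E"
proof -
  let ?N = "2 ^ n :: nat"
  interpret matrix_vs ?N ?N "TYPE(complex)" .
  obtain P where P: "orthogonal_projection ?N code_space P"
      and stab: "\<And>j. j < r \<Longrightarrow> stab j * P = P" "\<And>j. j < r \<Longrightarrow> P * stab j = P"
    using ex_code_projection by blast
  have Pc: "P \<in> carrier_mat ?N ?N" and PP: "P * P = P" using P by (auto simp: orthogonal_projection_def)
  note mat = assoc_mult_mat[of _ ?N ?N _ ?N _ ?N] mult_smult_assoc_mat[of _ ?N ?N _ ?N]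
    mult_smult_distrib[of _ ?N ?N _ ?N]
  have word: "\<exists>c. P * cl_word n ks * P = c \<cdot>\<^sub>m P"
    if ks: "sorted_wrt (<) ks" "set ks \<subseteq> {1..m}" "length ks \<le> 2" for ks
  proof (cases "ks = []")
    case True
    then show ?thesis using Pc PP by (intro exI[of _ 1]) simp
  next
    case False
    have sub: "set ks \<subseteq> {1..2 * n + 1}" using ks(2) m by auto
    note Wc = cl_word_carrier[OF sub]
    have lt: "a < 2 ^ r" if "a \<in> set ks" for a
      using subsetD[OF sub that] n by auto
    have "\<exists>j. odd (length (filter (\<lambda>a. bit a j) ks))"
    proof -
      consider a where "ks = [a]" | a b where "ks = [a, b]"
        using ks(3) False by (cases ks; cases "tl ks") auto
      then show ?thesis
      proof cases
        case 1
        then have "a \<noteq> 0" using sub by auto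
        then obtain j where "bit a j" by (metis bit_eqI bit_0_eq bot_apply bot_bool_def)
        then show ?thesis using 1 by (intro exI[of _ j]) simp
      next
        case 2
        then have "a \<noteq> b" using ks(1) by simp
        then obtain j where "bit a j \<noteq> bit b j" by (metis bit_eqI)
        then show ?thesis using 2 by (intro exI[of _ j]) auto
      qed
    qed
    then obtain j where j: "odd (length (filter (\<lambda>a. bit a j) ks))" by blast
    then have "filter (\<lambda>a. bit a j) ks \<noteq> []" by (intro notI) simp
    then obtain a where "a \<in> set ks" "bit a j" by (auto simp: filter_empty_conv)
    \<comment> \<open>The position j was found without a bound; being set in a label below 2 ^ r, it
      belongs to one of the r stabilizers.\<close>
    then have jr: "j < r" using lt less_exp_iff_bits by blast
    have anti: "stab j * cl_word n ks = - 1 \<cdot>\<^sub>m (cl_word n ks * stab j)"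
      using stab_commute_cl_word[OF sub jr] j by simp
    \<comment> \<open>P absorbs \<open>stab j\<close> on both sides, so passing it through the word
      shows that the product equals its own negative.\<close>
    have "P * cl_word n ks * P = (P * stab j) * cl_word n ks * P"
      by (simp add: stab jr)
    also have "\<dots> = P * (stab j * cl_word n ks) * P"
      using Pc Wc stab_carrier[of j] by (simp add: mat)
    also have "\<dots> = - 1 \<cdot>\<^sub>m (P * cl_word n ks * (stab j * P))"
      unfolding anti using Pc Wc stab_carrier[of j] by (simp add: mat)
    also have "\<dots> = - 1 \<cdot>\<^sub>m (P * cl_word n ks * P)"
      by (simp add: stab jr)
    finally have eq: "P * cl_word n ks * P = - 1 \<cdot>\<^sub>m (P * cl_word n ks * P)" .
    have "P * cl_word n ks * P = 0 \<cdot>\<^sub>m P"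
    proof (rule eq_matI)
      fix i k assume "i < dim_row (0 \<cdot>\<^sub>m P)" "k < dim_col (0 \<cdot>\<^sub>m P)"
      then have ik: "i < ?N" "k < ?N" using Pc by auto
      have "(P * cl_word n ks * P) $$ (i, k) = - 1 * (P * cl_word n ks * P) $$ (i, k)"
        by (subst eq) (use ik Pc in simp)
      then show "(P * cl_word n ks * P) $$ (i, k) = (0 \<cdot>\<^sub>m P) $$ (i, k)"
        using ik Pc by simp
    qed (use Pc in auto)
    then show ?thesis by blast
  qed
  have "\<exists>c. P * E * P = c \<cdot>\<^sub>m P"
    using E unfolding clifford_metric_def mat_span_def
  proof (induction rule: span_induct)
    case zero
    show ?case using Pc by (intro exI[of _ 0]) auto
  next
    case (base y)
    then obtain ks where "y = cl_word n ks" "sorted_wrt (<) ks" "set ks \<subseteq> {1..m}" "length ks \<le> 2"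
      by (auto simp: cl_word_def)
    then show ?case using word cl_word_carrier[of ks n] m by fastforce
  next
    case (add y z)
    then obtain c d where "P * y * P = c \<cdot>\<^sub>m P" "P * z * P = d \<cdot>\<^sub>m P" by blast
    then have "P * (y + z) * P = (c + d) \<cdot>\<^sub>m P"
      using Pc add(1,2) by (simp add: mult_add_distrib_mat[of _ ?N ?N _ ?N]
          add_mult_distrib_mat[of _ ?N ?N _ _ ?N] add_smult_distrib_right_mat)
    then show ?case by blast
  next
    case (smult c y)
    then obtain d where "P * y * P = d \<cdot>\<^sub>m P" by blast
    then have "P * (c \<cdot>\<^sub>m y) * P = (c * d) \<cdot>\<^sub>m P"
      using Pc smult(2) by (simp add: mat)
    then show ?case by blast
  qed
  then show ?thesis using P by (auto simp: detects_def)
qed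

section \<open>An undetected word of length three\<close>

text \<open>A word of zero syndrome commutes with every stabilizer, so it preserves their joint +1
  eigenspace.\<close>

lemma cl_word_code_space:
  assumes ks: "set ks \<subseteq> {1..2 * n + 1}"
    and even: "\<And>j. j < r \<Longrightarrow> even (length (filter (\<lambda>a. bit a j) ks))"
    and v: "v \<in> code_space"
  shows "cl_word n ks *\<^sub>v v \<in> code_space"
proof -
  have vc: "v \<in> carrier_vec (2 ^ n)" using v by (simp add: code_space_def)
  note Wc = cl_word_carrier[OF ks]
  have "stab j *\<^sub>v (cl_word n ks *\<^sub>v v) = cl_word n ks *\<^sub>v v" if j: "j < r" for j
  proof -
    have "stab j *\<^sub>v (cl_word n ks *\<^sub>v v) = (cl_word n ks * stab j) *\<^sub>v v"
      using stab_commute_cl_word[OF ks j] even[OF j] vc Wc stab_carrier[of j]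
      by (simp flip: assoc_mult_mat_vec)
    also have "\<dots> = cl_word n ks *\<^sub>v v"
      using v vc Wc stab_carrier[of j] j by (simp add: code_space_def)
    finally show ?thesis .
  qed
  then show ?thesis using vc Wc by (simp add: code_space_def)
qed

text \<open>A detected E would act on the code as a scalar c. As F preserves the code and
  anticommutes with E, c = -c, so E kills a nonzero vector although it is unitary. All t >= 3 are
  covered, since every larger candidate for the distance has to be excluded.\<close>

lemma clifford_metric_not_detects:
  assumes m: "2 * n \<le> m" "m \<le> 2 * n + 1" and t: "3 \<le> t"
  obtains E where "E \<in> clifford_metric n m t" "\<not> detects (2 ^ n) code_space E"
proof
  let ?N = "2 ^ n :: nat"
  \<comment> \<open>1 XOR 2 = 3 and 4 XOR 8 = 12 give two triples of zero syndrome without a common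
    label; moving one past the other takes nine swaps, hence the sign -1.\<close>
  define E where "E = cl_word n [1, 2, 3]"
  define F where "F = cl_word n [4, 8, 12]"
  have n12: "12 \<le> 2 * n"
  proof -
    have "(2 :: nat) ^ 4 \<le> 2 ^ r" using r by (intro power_increasing) auto
    then show ?thesis using n by simp
  qed
  \<comment> \<open>All labels involved are below 16, so only the bits 0 to 3 have to be
    inspected.\<close>
  have large: "\<not> bit a j" if "a < 16" "4 \<le> j" for a j :: nat
    using that less_exp_iff_bits[of a 4] by auto
  have evenE: "even (length (filter (\<lambda>a. bit a j) [1, 2, 3 :: nat]))" for j
  proof (cases "4 \<le> j")
    case False
    then consider "j = 0" | "j = 1" | "j = 2" | "j = 3" by linarith
    then show ?thesis by cases (auto simp: bit_iff_odd)
  qed (simp add: large)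
  have evenF: "even (length (filter (\<lambda>a. bit a j) [4, 8, 12 :: nat]))" for j
  proof (cases "4 \<le> j")
    case False
    then consider "j = 0" | "j = 1" | "j = 2" | "j = 3" by linarith
    then show ?thesis by cases (auto simp: bit_iff_odd)
  qed (simp add: large)
  have subE: "set [1, 2, 3] \<subseteq> {1..2 * n + 1}" and subF: "set [4, 8, 12] \<subseteq> {1..2 * n + 1}"
    using n12 by auto
  have E: "E \<in> carrier_mat ?N ?N" and F: "F \<in> carrier_mat ?N ?N"
    unfolding E_def F_def by (intro cl_word_carrier subE subF)+
  interpret matrix_vs ?N ?N "TYPE(complex)" .
  show "E \<in> clifford_metric n m t"
  proof -
    let ?S = "{mat_prod ?N (map (clifford_U n) ks) | ks.
        sorted_wrt (<) ks \<and> set ks \<subseteq> {1..m} \<and> int (length ks) \<le> \<lfloor>t\<rfloor>}"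
    have "?S \<subseteq> carrier_mat ?N ?N"
      using cl_word_carrier[of _ n] m(2) by (fastforce simp: cl_word_def)
    moreover have "E \<in> ?S"
      unfolding E_def cl_word_def
      using n12 m t by (intro CollectI exI[of _ "[1, 2, 3]"]) (auto simp: le_floor_iff)
    ultimately show ?thesis
      unfolding clifford_metric_def mat_span_def using span_mem by blast
  qed
  have FE: "F * E = - 1 \<cdot>\<^sub>m (E * F)"
  proof -
    have "commute_up_to (prod_list (map (\<lambda>_. - 1) [1, 2, 3 :: nat])) F (mat_prod ?N (map (clifford_U n) [1, 2, 3]))"
    proof (rule commute_up_to_mat_prod[OF F], intro conjI)
      fix a assume a: "a \<in> set [1, 2, 3 :: nat]"
      then have a': "a \<in> {1..2 * n + 1}" using subE by blast
      then show "clifford_U n a \<in> carrier_mat ?N ?N" by (rule clifford_U_carrier)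
      have "(- 1 :: complex) ^ length (filter (\<lambda>b. b \<noteq> a) [4, 8, 12]) = - 1"
        using a by auto
      then have "commute_up_to (- 1) (clifford_U n a) F"
        using clifford_U_commute_cl_word[OF a' subF] by (simp only: F_def)
      then show "commute_up_to (- 1) F (clifford_U n a)"
        by (rule commute_up_to_sym) simp
    qed
    then show ?thesis by (simp add: commute_up_to_def E_def cl_word_def)
  qed
  have inj: "X *\<^sub>v v \<noteq> 0\<^sub>v ?N"
    if X: "X \<in> carrier_mat ?N ?N" "mat_adjoint X * X = 1\<^sub>m ?N" and v: "v \<in> carrier_vec ?N" "v \<noteq> 0\<^sub>v ?N" for X v
  proof
    assume "X *\<^sub>v v = 0\<^sub>v ?N"
    then have "mat_adjoint X *\<^sub>v (X *\<^sub>v v) = 0\<^sub>v ?N"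
      using mult_mat_zero_vec[OF mat_adjoint_carrier[OF X(1)]] by simp
    moreover have "mat_adjoint X *\<^sub>v (X *\<^sub>v v) = v"
      using X(2) v(1) assoc_mult_mat_vec[OF mat_adjoint_carrier[OF X(1)] X(1) v(1)] by simp
    ultimately show False using v(2) by simp
  qed
  show "\<not> detects ?N code_space E"
  proof
    assume "detects ?N code_space E"
    then obtain P c where P: "orthogonal_projection ?N code_space P" and PEP: "P * E * P = c \<cdot>\<^sub>m P"
      by (auto simp: detects_def)
    have Pc: "P \<in> carrier_mat ?N ?N" using P by (simp add: orthogonal_projection_def)
    \<comment> \<open>P is whatever projection witnesses detection; its image and idempotence show
      that it fixes the code.\<close>
    have PW: "P *\<^sub>v w = w" if "w \<in> code_space" for w
    proof -
      have "w \<in> (\<lambda>u. P *\<^sub>v u) ` carrier_vec ?N"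
        using P that by (simp add: orthogonal_projection_def)
      then obtain u where u: "u \<in> carrier_vec ?N" "w = P *\<^sub>v u"
        by blast
      have "P *\<^sub>v (P *\<^sub>v u) = (P * P) *\<^sub>v u" using Pc u(1) by simp
      then show ?thesis using P u(2) by (simp add: orthogonal_projection_def)
    qed
    have EW: "E *\<^sub>v w = c \<cdot>\<^sub>v w" if w: "w \<in> code_space" for w
    proof -
      have wc: "w \<in> carrier_vec ?N" using w by (simp add: code_space_def)
      have "E *\<^sub>v w \<in> code_space"
        unfolding E_def using subE evenE w by (rule cl_word_code_space)
      then have "E *\<^sub>v w = P *\<^sub>v (E *\<^sub>v (P *\<^sub>v w))" using PW w by simp
      also have "\<dots> = (P * E * P) *\<^sub>v w"
        using Pc E wc by (simp add: assoc_mult_mat_vec[of _ ?N ?N _ ?N])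
      also have "\<dots> = c \<cdot>\<^sub>v w"
        unfolding PEP using Pc wc by (simp add: smult_mat_mult_vec PW w)
      finally show ?thesis .
    qed
    obtain v where v: "v \<in> code_space" "v \<noteq> 0\<^sub>v ?N" by (rule ex_nonzero_code_space)
    have vc: "v \<in> carrier_vec ?N" using v(1) by (simp add: code_space_def)
    have FvW: "F *\<^sub>v v \<in> code_space"
      unfolding F_def using subF evenF v(1) by (rule cl_word_code_space)
    have Fv: "F *\<^sub>v v \<noteq> 0\<^sub>v ?N"
      by (rule inj[OF F _ vc v(2)]) (simp only: F_def cl_word_unitary[OF subF])
    have "c \<cdot>\<^sub>v (F *\<^sub>v v) = (F * E) *\<^sub>v v"
      using F E vc by (simp add: EW[OF v(1)] mult_mat_vec[OF F vc])
    also have "\<dots> = - 1 \<cdot>\<^sub>v (E *\<^sub>v (F *\<^sub>v v))"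
      unfolding FE using F E vc by (simp add: smult_mat_mult_vec)
    also have "\<dots> = (- c) \<cdot>\<^sub>v (F *\<^sub>v v)"
      by (simp add: EW[OF FvW] smult_smult_assoc)
    finally have "c = - c"
      by (rule smult_vec_cancel_right) (use F Fv in auto)
    then have "E *\<^sub>v v = 0 \<cdot>\<^sub>v v"
      using EW[OF v(1)] by simp
    also have "\<dots> = 0\<^sub>v ?N"
      by (rule eq_vecI) (use vc in auto)
    finally have "E *\<^sub>v v = 0\<^sub>v ?N" .
    moreover have "E *\<^sub>v v \<noteq> 0\<^sub>v ?N"
      by (rule inj[OF E _ vc v(2)]) (simp only: E_def cl_word_unitary[OF subE])
    ultimately show False by simp
  qed
qed

lemma code_space_distance:
  assumes "m \<in> {2 * n, 2 * n + 1}"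
  shows "has_distance (2 ^ n) (clifford_metric n m) code_space 3"
proof -
  have "d \<le> 3" if d: "\<forall>E \<in> clifford_metric n m (real d - 1). detects (2 ^ n) code_space E" for d
  proof (rule ccontr)
    assume "\<not> d \<le> 3"
    \<comment> \<open>Since d is a natural number, exceeding 3 means d - 1 >= 3, which admits words
      of length three.\<close>
    then have "3 \<le> real d - 1" "2 * n \<le> m" "m \<le> 2 * n + 1" using assms by auto
    then show False using d clifford_metric_not_detects[of m "real d - 1"] by blast
  qed
  moreover have "detects (2 ^ n) code_space E" if "E \<in> clifford_metric n m (real 3 - 1)" for E
    using clifford_metric_detects[of m E] that assms by auto
  ultimately show ?thesis
    using code_space_subspace by (simp add: has_distance_def)
qed

end

theorem proposition2p5p1:
  fixes s n k :: nat
  assumes "s \<ge> 3"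
    and "n = 2 ^ s - 1"
    and "k = 2 ^ s - s - 2"
  shows "\<exists>C W. q_isotropic n C \<and> subspace_dim (2 * n) C = n - k \<and>
           simultaneous_eigenspace n C W \<and> subspace_dim (2 ^ n) W = 2 ^ k \<and>
           has_distance (2 ^ n) (clifford_metric n (2 * n)) W 3 \<and>
           has_distance (2 ^ n) (clifford_metric n (2 * n + 1)) W 3"
proof -
  have "n + 1 = 2 ^ s" using assms(2) by simp
  then interpret clifford_hamming "s + 1" n
    using assms(1) by unfold_locales simp_all
  have "k = n - (s + 1)" using assms by simp
  \<comment> \<open>Subtraction of natural numbers truncates, so \<open>r_le_n\<close> is used to
    recover s + 1 from n - (n - (s + 1)).\<close>
  moreover from this have "n - k = s + 1" using r_le_n by simp
  ultimately show ?thesis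
    using code_isotropic code_dim code_space_eigenspace code_space_dim
      code_space_distance[of "2 * n"] code_space_distance[of "2 * n + 1"]
    by (intro exI[of _ code] exI[of _ code_space]) simp
qed

end
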